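(* Let $0<\alpha<n$, let $1<p\le q<\infty$, and let $\sigma,w$ be two weights on $\mathbb{R}^n$. Let $\epsilon_p$ and $\epsilon_{q'}$ be positive monotonic increasing functions on $[1,\infty)$ satisfying $\int_1^\infty \frac{dt}{t\,\epsilon_p(t)^p}=1$ and $\int_1^\infty \frac{dt}{t\,\epsilon_{q'}(t)^{q'}}=1$. For a cube $Q$ define $$\beta(Q):=\frac{\sigma(Q)^{1/p'}\,w(Q)^{1/q}}{|Q|^{1-\alpha/n}}\,\rho_\sigma(Q)^{1/p}\,\epsilon_p(\rho_\sigma(Q))\,\rho_w(Q)^{1/q'}\,\epsilon_{q'}(\rho_w(Q)),$$ and set $\lfloor\sigma,w\rfloor:=\sup_Q\beta(Q)$, the supremum being over all cubes $Q\subset\mathbb{R}^n$. Then there are a constant $C_{\alpha,n}$ depending only on $\alpha$ and $n$, and a constant $C$ depending only on $n,\alpha,p,q,\epsilon_p,\epsilon_{q'}$ (not on $f,\sigma,w$), such that for all $f\in L^p(\sigma)$ $$\|I_\alpha(f\sigma)\|_{L^q(w)}\le C\,C_{\alpha,n}\,\lfloor\sigma,w\rfloor\,\|f\|_{L^p(\sigma)}.$$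
   Context: A weight is a non-negative locally integrable function on $\mathbb{R}^n$. For a weight $\sigma$, $\sigma(Q)=\int_Q\sigma\,dx$, and $L^p(\sigma)$ is the $L^p$ space of the measure $\sigma\,dx$. $|Q|$ is Lebesgue measure; $p',q'$ are the conjugate exponents of $p,q$. The fractional integral operator is $$I_\alpha f(x):=\int_{\mathbb{R}^n}\frac{f(y)}{|y-x|^{n-\alpha}}\,dy .$$ $M$ denotes the Hardy–Littlewood maximal operator, $Mf(x)=\sup_{Q\text{ a cube}}\frac{\mathbf 1_Q(x)}{|Q|}\int_Q|f|\,dy$, and for a weight $\mu\in\{\sigma,w\}$ $$\rho_\mu(Q):=\frac{1}{\mu(Q)}\int_Q M(\mu\mathbf 1_Q)\,dx ,$$ so $\rho_\mu(Q)\in[1,\infty]$ when $\mu(Q)>0$. Conventions: $\beta(Q)=0$ if $\sigma(Q)=0$ or $w(Q)=0$; otherwise $\beta(Q)=\infty$ if $\rho_\sigma(Q)=\infty$ or $\rho_w(Q)=\infty$. The inequality is regarded as trivially true when $\lfloor\sigma,w\rfloor=\infty$. *)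

theory Defs
  imports "HOL-Analysis.Analysis"
begin

text \<open>Cubes are axis-parallel and nondegenerate. They are taken closed; every quantity below is
  the same for open or half-open cubes.\<close>

definition cubes :: "(real ^ 'n) set set" where
  "cubes = {cbox a (a + vec r) | a r. 0 < r}"

definition is_weight :: "(real ^ 'n \<Rightarrow> real) \<Rightarrow> bool" where
  "is_weight \<mu> \<longleftrightarrow> (\<forall>x. 0 \<le> \<mu> x) \<and> (\<forall>K. compact K \<longrightarrow> set_integrable lebesgue K \<mu>)"

definition weight_measure :: "(real ^ 'n \<Rightarrow> real) \<Rightarrow> (real ^ 'n) measure" where
  "weight_measure \<mu> = density lebesgue (\<lambda>x. ennreal (\<mu> x))"

text \<open>The power \<open>x\<^sup>a\<close> of an extended nonnegative number, meant for \<open>a > 0\<close>.\<close>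

definition ennreal_powr :: "ennreal \<Rightarrow> real \<Rightarrow> ennreal" where
  "ennreal_powr x a = (if x = \<infinity> then \<infinity> else ennreal (enn2real x powr a))"

definition Lp_norm :: "real \<Rightarrow> 'b measure \<Rightarrow> ('b \<Rightarrow> 'a :: real_normed_vector) \<Rightarrow> ennreal" where
  "Lp_norm p M f = ennreal_powr (\<integral>\<^sup>+x. ennreal (norm (f x) powr p) \<partial>M) (1 / p)"

definition Lp_space :: "real \<Rightarrow> 'b measure \<Rightarrow> ('b \<Rightarrow> 'a :: real_normed_vector) set" where
  "Lp_space p M = {f \<in> borel_measurable M. Lp_norm p M f < \<infinity>}"

definition conj_exp :: "real \<Rightarrow> real" where
  "conj_exp p = p / (p - 1)"

text \<open>The integrand at \<open>y = x\<close> is 0 (division by zero), which only concerns a null set.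
  The Bochner integral is 0 where the integral does not converge absolutely, so statements
  about \<open>frac_integral\<close> have to be accompanied by \<open>frac_integral_converges\<close>.\<close>

definition frac_integrand ::
    "real \<Rightarrow> (real ^ 'n \<Rightarrow> 'a :: {banach, second_countable_topology}) \<Rightarrow> real ^ 'n \<Rightarrow> real ^ 'n \<Rightarrow> 'a" where
  "frac_integrand \<alpha> f x y = f y /\<^sub>R (norm (y - x) powr (real CARD('n) - \<alpha>))"

definition frac_integral ::
    "real \<Rightarrow> (real ^ 'n \<Rightarrow> 'a :: {banach, second_countable_topology}) \<Rightarrow> real ^ 'n \<Rightarrow> 'a" where
  "frac_integral \<alpha> f x = (\<integral>y. frac_integrand \<alpha> f x y \<partial>lebesgue)"

definition frac_integral_converges ::
    "real \<Rightarrow> (real ^ 'n \<Rightarrow> 'a :: {banach, second_countable_topology}) \<Rightarrow> real ^ 'n \<Rightarrow> bool" where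
  "frac_integral_converges \<alpha> f x \<longleftrightarrow> integrable lebesgue (frac_integrand \<alpha> f x)"

definition maximal_function :: "(real ^ 'n \<Rightarrow> real) \<Rightarrow> real ^ 'n \<Rightarrow> ennreal" where
  "maximal_function f x =
     (SUP Q\<in>cubes. indicator Q x / emeasure lebesgue Q * (\<integral>\<^sup>+y\<in>Q. ennreal \<bar>f y\<bar> \<partial>lebesgue))"

text \<open>Only used when \<open>\<mu>(Q) > 0\<close>.\<close>

definition rho :: "(real ^ 'n \<Rightarrow> real) \<Rightarrow> (real ^ 'n) set \<Rightarrow> ennreal" where
  "rho \<mu> Q =
     (\<integral>\<^sup>+x\<in>Q. maximal_function (\<lambda>y. \<mu> y * indicator Q y) x \<partial>lebesgue)
       / emeasure (weight_measure \<mu>) Q"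

definition entropy_function :: "real \<Rightarrow> (real \<Rightarrow> real) \<Rightarrow> bool" where
  "entropy_function s \<epsilon> \<longleftrightarrow>
     (\<forall>t\<ge>1. 0 < \<epsilon> t) \<and> mono_on {1..} \<epsilon> \<and>
     (\<integral>\<^sup>+t\<in>{1..}. ennreal (1 / (t * \<epsilon> t powr s)) \<partial>lborel) = 1"

text \<open>\<open>\<epsilon>\<close> plays the role of \<open>\<epsilon>\<^sub>p\<close>, and \<open>\<epsilon>'\<close> that of \<open>\<epsilon>\<^sub>q\<^sub>'\<close>.\<close>

definition beta ::
    "real \<Rightarrow> real \<Rightarrow> real \<Rightarrow> (real \<Rightarrow> real) \<Rightarrow> (real \<Rightarrow> real) \<Rightarrow>
     (real ^ 'n \<Rightarrow> real) \<Rightarrow> (real ^ 'n \<Rightarrow> real) \<Rightarrow> (real ^ 'n) set \<Rightarrow> ennreal" where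
  "beta \<alpha> p q \<epsilon> \<epsilon>' \<sigma> w Q =
     (if emeasure (weight_measure \<sigma>) Q = 0 \<or> emeasure (weight_measure w) Q = 0 then 0
      else if rho \<sigma> Q = \<infinity> \<or> rho w Q = \<infinity> then \<infinity>
      else
        (let r\<^sub>\<sigma> = enn2real (rho \<sigma> Q); r\<^sub>w = enn2real (rho w Q)
         in ennreal
           (measure (weight_measure \<sigma>) Q powr (1 / conj_exp p)
              * measure (weight_measure w) Q powr (1 / q)
              / measure lebesgue Q powr (1 - \<alpha> / real CARD('n))
            * r\<^sub>\<sigma> powr (1 / p) * \<epsilon> r\<^sub>\<sigma>
            * r\<^sub>w powr (1 / conj_exp q) * \<epsilon>' r\<^sub>w)))"

definition entropy_bracket ::
    "real \<Rightarrow> real \<Rightarrow> real \<Rightarrow> (real \<Rightarrow> real) \<Rightarrow> (real \<Rightarrow> real) \<Rightarrow>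
     (real ^ 'n \<Rightarrow> real) \<Rightarrow> (real ^ 'n \<Rightarrow> real) \<Rightarrow> ennreal" where
  "entropy_bracket \<alpha> p q \<epsilon> \<epsilon>' \<sigma> w = (SUP Q\<in>cubes. beta \<alpha> p q \<epsilon> \<epsilon>' \<sigma> w Q)"

end

theory Submission
  imports Defs
begin

text \<open>By the one-third trick the fractional integral is dominated by finitely many dyadic operators
  \<open>\<Sum>\<^sub>Q |Q|\<^bsup>\<alpha>/n - 1\<^esup> (\<integral>\<^sub>Q f \<sigma>) 1\<^sub>Q\<close>. Tested against \<open>g w\<close>, such an operator
  reduces to the principal cubes of \<open>f \<sigma>\<close>, which are sparse for Lebesgue measure. On a principal
  cube one writes \<open>\<sigma>(Q) w(Q) |Q|\<^bsup>\<alpha>/n - 1\<^esup>\<close> as \<open>\<beta>(Q)\<close> times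
  \<open>(\<sigma>(Q) / (\<rho>\<^sub>\<sigma> \<epsilon>\<^sub>p(\<rho>\<^sub>\<sigma>)\<^sup>p))\<^bsup>1/p\<^esup>\<close> and the analogous factor for \<open>w\<close>.
  Hoelder's inequality separates the two factors, and each resulting sum is a Carleson embedding:
  sparseness bounds the sum of \<open>\<sigma>\<close> over the subcubes of \<open>Q\<close> by the integral of \<open>M(\<sigma> 1\<^sub>Q)\<close>, so the
  cubes with \<open>\<rho>\<^sub>\<sigma>\<close> of size about \<open>2\<^sup>k\<close> pack with a constant of order \<open>2\<^sup>k\<close>, and the series of
  \<open>\<epsilon>\<^sub>p(2\<^sup>k)\<^bsup>-p\<^esup>\<close> is controlled by the integral condition. The strong type bound follows on choosing
  \<open>g\<close> to be the \<open>(q - 1)\<close>-st power of a finite dyadic sum.\<close>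

section \<open>Laminar families and the Carleson embedding\<close>

text \<open>The averages hidden in \<open>rho\<close> are taken with respect to Lebesgue measure.
  This is why principal cubes are selected by Lebesgue averages of \<open>f \<sigma>\<close> and not
  by \<open>\<sigma>\<close>-averages of \<open>f\<close>: the disjoint parts \<open>E R\<close>
  then fill at least half of \<open>R\<close> in Lebesgue measure, so a single family serves the
  packing estimates of both weights, although neither \<open>w\<close> nor \<open>g\<close> took
  part in the selection.

  Dividing the masses by \<open>rho\<close> alone would make each scale \<open>2^k\<close> of
  \<open>rho\<close> harmless but leave arbitrarily many scales, each contributing a bounded amount;
  the entropy factor makes these contributions summable. The integral condition controls
  \<open>\<epsilon> (2^k)\<close> only for \<open>k \<ge> 1\<close>, so \<open>\<epsilon> 1\<close>
  enters the constant separately.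

  Every family is finite. This keeps finite the quantities that are absorbed or divided out, and
  since no constant depends on the family, monotone convergence reaches the full operator at the
  end.\<close>

definition laminar :: "'a set set \<Rightarrow> bool" where
  "laminar F \<longleftrightarrow> (\<forall>A\<in>F. \<forall>B\<in>F. A \<subseteq> B \<or> B \<subseteq> A \<or> A \<inter> B = {})"

lemma laminarD: "laminar F \<Longrightarrow> A \<in> F \<Longrightarrow> B \<in> F \<Longrightarrow> A \<subseteq> B \<or> B \<subseteq> A \<or> A \<inter> B = {}"
  unfolding laminar_def by blast

lemma laminar_subset: "laminar F \<Longrightarrow> G \<subseteq> F \<Longrightarrow> laminar G"
  unfolding laminar_def by blast

section \<open>Maximal and principal members of a finite family\<close>

lemma laminar_maximal:
  assumes "finite F" "laminar F"
  shows "\<exists>G\<subseteq>F. disjoint G \<and> (\<forall>Q\<in>F. \<exists>R\<in>G. Q \<subseteq> R)"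
proof (intro exI conjI ballI)
  let ?G = "{R\<in>F. \<forall>Q\<in>F. R \<subseteq> Q \<longrightarrow> R = Q}"
  show "?G \<subseteq> F" by blast
  show "disjoint ?G"
  proof (rule disjointI)
    fix A B assume "A \<in> ?G" "B \<in> ?G" "A \<noteq> B"
    then show "A \<inter> B = {}" using laminarD[OF assms(2), of A B] by auto
  qed
  fix Q assume "Q \<in> F"
  then obtain R where "R \<in> F" "Q \<subseteq> R" "\<forall>B\<in>F. R \<subseteq> B \<longrightarrow> R = B"
    using finite_has_maximal2[OF assms(1), of Q] by auto
  then show "\<exists>R\<in>?G. Q \<subseteq> R" by blast
qed

text \<open>Greedy selection from large sets to small: a set is kept only if no kept set above it
  has at least half its value of \<open>l\<close>. Peeling off an inclusion-minimal set in the
  induction means that this set is decided last. When added, it can only be the smaller member of a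
  nested pair, so the growth along the earlier pairs is not disturbed.\<close>

lemma principal_subfamily:
  fixes l :: "'a set \<Rightarrow> real"
  assumes "finite F" "\<And>Q. Q \<in> F \<Longrightarrow> 0 \<le> l Q"
  obtains S where "S \<subseteq> F" "\<And>Q. Q \<in> F \<Longrightarrow> \<exists>R\<in>S. Q \<subseteq> R \<and> l Q \<le> 2 * l R"
    "\<And>R R'. R \<in> S \<Longrightarrow> R' \<in> S \<Longrightarrow> R' \<subset> R \<Longrightarrow> 2 * l R < l R'"
proof -
  have "\<exists>S\<subseteq>F. (\<forall>Q\<in>F. \<exists>R\<in>S. Q \<subseteq> R \<and> l Q \<le> 2 * l R) \<and>
      (\<forall>R\<in>S. \<forall>R'\<in>S. R' \<subset> R \<longrightarrow> 2 * l R < l R')"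
    using assms
  proof (induction F rule: finite_psubset_induct)
    case (psubset F)
    show ?case
    proof (cases "F = {}")
      case False
      then obtain Q where Q: "Q \<in> F" "\<And>B. B \<in> F \<Longrightarrow> B \<subseteq> Q \<Longrightarrow> Q = B"
        using finite_has_minimal[OF psubset(1)] by metis
      have "\<exists>S\<subseteq>F-{Q}. (\<forall>P\<in>F-{Q}. \<exists>R\<in>S. P \<subseteq> R \<and> l P \<le> 2 * l R) \<and>
          (\<forall>R\<in>S. \<forall>R'\<in>S. R' \<subset> R \<longrightarrow> 2 * l R < l R')"
        using Q(1) by (intro psubset.IH psubset.prems) auto
      then obtain S where S: "S \<subseteq> F - {Q}" "\<And>P. P \<in> F - {Q} \<Longrightarrow> \<exists>R\<in>S. P \<subseteq> R \<and> l P \<le> 2 * l R"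
          "\<And>R R'. R \<in> S \<Longrightarrow> R' \<in> S \<Longrightarrow> R' \<subset> R \<Longrightarrow> 2 * l R < l R'"
        by metis
      show ?thesis
      proof (cases "\<exists>R\<in>S. Q \<subseteq> R \<and> l Q \<le> 2 * l R")
        case True
        then have "\<forall>P\<in>F. \<exists>R\<in>S. P \<subseteq> R \<and> l P \<le> 2 * l R"
          using S(2) by (metis Diff_iff singletonD)
        moreover have "S \<subseteq> F" using S(1) by blast
        ultimately show ?thesis using S(3) by metis
      next
        case no: False
        have "l Q \<le> 2 * l Q" using psubset.prems[OF Q(1)] by simp
        moreover have "2 * l R < l R'" if "R \<in> insert Q S" "R' \<in> insert Q S" "R' \<subset> R" for R R'
        proof -
          have "R \<in> S" using that Q(2) S(1) by blast
          then show ?thesis using that S(3) no by (cases "R' = Q") (auto simp: not_le)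
        qed
        moreover have "\<exists>R\<in>insert Q S. P \<subseteq> R \<and> l P \<le> 2 * l R" if "P \<in> F" for P
          using S(2)[of P] that \<open>l Q \<le> 2 * l Q\<close> by (cases "P = Q") auto
        moreover have "insert Q S \<subseteq> F" using S(1) Q(1) by blast
        ultimately show ?thesis by metis
      qed
    qed simp
  qed
  with that show ?thesis by metis
qed

section \<open>Geometric growth and the Carleson embedding\<close>

lemma sum_powr_doubling:
  fixes X :: "real set"
  assumes "finite X" "\<And>a. a \<in> X \<Longrightarrow> 0 \<le> a" "\<And>a b. a \<in> X \<Longrightarrow> b \<in> X \<Longrightarrow> a < b \<Longrightarrow> 2 * a < b"
    "0 < r" "X \<noteq> {}"
  shows "(\<Sum>a\<in>X. a powr r) \<le> Max X powr r / (1 - 2 powr - r)"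
  using assms
proof (induction X rule: finite_linorder_max_induct)
  case (insert b X)
  define c where "c = 1 - 2 powr - r"
  have c: "0 < c" "c \<le> 1" using \<open>0 < r\<close> unfolding c_def by (auto simp: powr_less_one)
  have Mb: "Max (insert b X) = b"
    using insert by (intro Max_eqI) (auto intro: less_imp_le)
  have b: "0 \<le> b" using insert by simp
  show ?case
  proof (cases "X = {}")
    case True
    have "b powr r * c \<le> b powr r * 1" using c by (intro mult_left_mono) auto
    with True show ?thesis using c by (simp add: c_def field_simps)
  next
    case False
    let ?m = "Max X"
    have m: "?m \<in> X" using False insert by simp
    then have "0 \<le> ?m" "2 * ?m < b" using insert by auto
    then have "?m powr r \<le> (b / 2) powr r" using \<open>0 < r\<close> by (intro powr_mono2) auto
    also have "\<dots> = b powr r * 2 powr - r" using b by (simp add: powr_divide powr_minus_divide)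
    finally have 1: "?m powr r \<le> b powr r * 2 powr - r" .
    have "(\<Sum>a\<in>X. a powr r) \<le> ?m powr r / c"
      using insert False unfolding c_def by (intro insert.IH) auto
    also have "\<dots> \<le> b powr r * 2 powr - r / c" using 1 c by (simp add: divide_right_mono)
    finally have "(\<Sum>a\<in>insert b X. a powr r) \<le> b powr r + b powr r * 2 powr - r / c"
      using insert by (subst sum.insert) auto
    \<comment> \<open>The bound is a fixed point of the recursion: the sum \<open>1 / c\<close> of
      the geometric series of ratio \<open>1 - c\<close> satisfies
      \<open>1 + (1 - c) / c = 1 / c\<close>.\<close>
    also have "2 powr - r = 1 - c" by (simp add: c_def)
    also have "b powr r + b powr r * (1 - c) / c = b powr r / c" using c by (simp add: field_simps)
    finally show ?thesis by (simp only: c_def Mb)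
  qed
qed simp

text \<open>Young's inequality for the exponents \<open>p\<close> and \<open>p / (p - 1)\<close>, in
  a form that separates \<open>f\<close> from the power \<open>p - 1\<close> of its averages. The
  coefficient \<open>1 - 1 / p < 1\<close> of \<open>b powr p\<close> is what permits absorption
  later.\<close>

lemma Youngs_powr:
  fixes a b p :: real
  assumes "1 < p" "0 \<le> a" "0 \<le> b"
  shows "a * b powr (p - 1) \<le> a powr p / p + (1 - 1 / p) * b powr p"
proof (cases "a = 0 \<or> b = 0")
  case True
  then show ?thesis using assms by (auto intro!: mult_nonneg_nonneg add_nonneg_nonneg)
next
  case False
  then have ab: "0 < a" "0 < b" using assms by auto
  have "(a powr p) powr (1 / p) * (b powr p) powr (1 - 1 / p) \<le> (1 / p) * a powr p + (1 - 1 / p) * b powr p"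
    by (intro Youngs_inequality_0) (use assms ab in auto)
  moreover have "(a powr p) powr (1 / p) = a" using assms ab by (simp add: powr_powr)
  moreover have "(b powr p) powr (1 - 1 / p) = b powr (p - 1)" 
    using assms by (simp add: powr_powr right_diff_distrib)
  ultimately show ?thesis by simp
qed

text \<open>With \<open>T\<close> the sum of \<open>l R powr p * measure M R\<close> over the
  principal sets, the left side is at most \<open>A * 2 powr p * T\<close>. One factor
  \<open>l R\<close> in \<open>T\<close> is unfolded into an integral of \<open>f\<close>; at each
  point the remaining powers \<open>l R powr (p - 1)\<close> grow geometrically along the principal
  sets containing it, so their sum is comparable to its largest term. Young's inequality then bounds
  \<open>T\<close> by a multiple of the integral of \<open>f powr p\<close> plus
  \<open>(1 - 1 / p) * T\<close>, which is absorbed. The geometric series has ratio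
  \<open>2 powr (1 - p)\<close>, whence \<open>c\<close>.\<close>

lemma Carleson_embedding:
  fixes f :: "'a \<Rightarrow> real" and p A :: real
  defines "c \<equiv> 1 / (1 - 2 powr (1 - p))"
  assumes p: "1 < p" and F: "finite F" "laminar F" "F \<subseteq> sets M"
    and fin: "\<And>Q. Q \<in> F \<Longrightarrow> emeasure M Q < \<infinity>" and pos: "\<And>Q. Q \<in> F \<Longrightarrow> 0 < measure M Q"
    and f: "\<And>x. 0 \<le> f x" "\<And>Q. Q \<in> F \<Longrightarrow> set_integrable M Q f" "integrable M (\<lambda>x. f x powr p)"
    and a: "\<And>Q. Q \<in> F \<Longrightarrow> 0 \<le> a Q" and A: "0 \<le> A"
    and Carleson: "\<And>R. R \<in> F \<Longrightarrow> (\<Sum>Q\<in>{Q\<in>F. Q \<subseteq> R}. a Q) \<le> A * measure M R"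
  shows "(\<Sum>Q\<in>F. a Q * ((LINT x:Q|M. f x) / measure M Q) powr p)
    \<le> A * (2 * c) powr p * (LINT x|M. f x powr p)"
proof -
  define l where "l Q = (LINT x:Q|M. f x) / measure M Q" for Q
  have intn: "0 \<le> (LINT x:Q|M. f x)" for Q
    unfolding set_lebesgue_integral_def using f(1) by (intro integral_nonneg_AE) auto
  have l0: "0 \<le> l Q" for Q
    unfolding l_def using intn by simp
  obtain S where S: "S \<subseteq> F" "\<And>Q. Q \<in> F \<Longrightarrow> \<exists>R\<in>S. Q \<subseteq> R \<and> l Q \<le> 2 * l R"
    "\<And>R R'. R \<in> S \<Longrightarrow> R' \<in> S \<Longrightarrow> R' \<subset> R \<Longrightarrow> 2 * l R < l R'"
    using principal_subfamily[OF F(1), of l] l0 by metis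
  have finS: "finite S" using S(1) F(1) finite_subset by blast
  have c0: "0 < c" using p unfolding c_def by (simp add: powr_less_one)
  define T where "T = (\<Sum>R\<in>S. l R powr p * measure M R)"
  define I where "I = (LINT x|M. f x powr p)"
  \<comment> \<open>A set \<open>Q\<close> is charged to every principal set above it, not just to
    the one that controls \<open>l Q\<close>; the surplus terms are nonnegative, and the order of
    summation can then be exchanged.\<close>
  have "(\<Sum>Q\<in>F. a Q * l Q powr p) \<le> (\<Sum>Q\<in>F. \<Sum>R\<in>S. if Q \<subseteq> R then a Q * (2 * l R) powr p else 0)"
  proof (rule sum_mono)
    fix Q assume Q: "Q \<in> F"
    then obtain R where R: "R \<in> S" "Q \<subseteq> R" "l Q \<le> 2 * l R" using S(2) by metis
    have "a Q * l Q powr p \<le> a Q * (2 * l R) powr p"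
      using R Q a p l0 by (intro mult_left_mono powr_mono2) auto
    also have "\<dots> = (\<Sum>R\<in>{R}. if Q \<subseteq> R then a Q * (2 * l R) powr p else 0)" using R by simp
    also have "\<dots> \<le> (\<Sum>R\<in>S. if Q \<subseteq> R then a Q * (2 * l R) powr p else 0)"
      using finS R Q a by (intro sum_mono2) auto
    finally show "a Q * l Q powr p \<le> \<dots>" .
  qed
  also have "\<dots> = (\<Sum>R\<in>S. \<Sum>Q\<in>F. if Q \<subseteq> R then a Q * (2 * l R) powr p else 0)"
    by (rule sum.swap)
  also have "\<dots> = (\<Sum>R\<in>S. (\<Sum>Q\<in>{Q\<in>F. Q \<subseteq> R}. a Q) * (2 * l R) powr p)"
    by (simp add: sum.inter_filter[symmetric] F(1) sum_distrib_right)
  also have "\<dots> \<le> (\<Sum>R\<in>S. A * measure M R * (2 * l R) powr p)"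
    using S(1) Carleson by (intro sum_mono mult_right_mono) auto
  also have "\<dots> = A * 2 powr p * T"
    unfolding T_def using l0 by (simp add: sum_distrib_left powr_mult algebra_simps)
  finally have 1: "(\<Sum>Q\<in>F. a Q * l Q powr p) \<le> A * 2 powr p * T" .
  have intR: "integrable M (\<lambda>x. indicator R x * f x)" if "R \<in> S" for R
    using f(2)[of R] that S(1) unfolding set_integrable_def by auto
  have intI: "integrable M (\<lambda>x. indicator R x * k)" if "R \<in> S" for R and k :: real
  proof -
    have "R \<in> sets M" "emeasure M R < \<infinity>" using that S(1) F(3) fin by auto
    then show ?thesis by (intro integrable_mult_left integrable_real_indicator)
  qed
  have pw: "(\<Sum>R\<in>S. l R powr (p - 1) * (indicator R x * f x))
      \<le> c powr p * f x powr p / p + (1 - 1 / p) * (\<Sum>R\<in>S. indicator R x * l R powr p)" for x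
  proof -
    define C where "C = {R\<in>S. x \<in> R}"
    have finC: "finite C" using finS C_def by simp
    have L: "(\<Sum>R\<in>S. l R powr (p - 1) * (indicator R x * f x)) = f x * (\<Sum>R\<in>C. l R powr (p - 1))"
      unfolding C_def sum_distrib_left sum.inter_filter[OF finS]
      by (intro sum.cong) (auto simp: indicator_def)
    have Rr: "(\<Sum>R\<in>S. indicator R x * l R powr p) = (\<Sum>R\<in>C. l R powr p)"
      unfolding C_def sum.inter_filter[OF finS] by (intro sum.cong) (auto simp: indicator_def)
    have dbl: "2 * l R < l R' \<or> 2 * l R' < l R" if "R \<in> C" "R' \<in> C" "R \<noteq> R'" for R R'
    proof -
      have "R \<subset> R' \<or> R' \<subset> R"
        using that laminarD[OF F(2), of R R'] S(1) unfolding C_def by blast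
      then show ?thesis using S(3)[of R R'] S(3)[of R' R] that unfolding C_def by auto
    qed
    \<comment> \<open>Distinct members of the chain have distinct averages, since
      \<open>2 * l R < l R'\<close> excludes equality of nonnegative values. The sum over sets is
      thus a sum over numbers, to which \<open>sum_powr_doubling\<close> applies.\<close>
    have inj: "inj_on l C"
    proof (rule inj_onI, rule ccontr)
      fix R R' assume "R \<in> C" "R' \<in> C" "l R = l R'" "R \<noteq> R'"
      then show False using dbl[of R R'] l0[of R] by simp
    qed
    show ?thesis
    proof (cases "C = {}")
      case True
      then show ?thesis unfolding L Rr using p by simp
    next
      case False
      let ?m = "Max (l ` C)"
      have m: "?m \<in> l ` C" using False finC by simp
      then have m0: "0 \<le> ?m" using l0 by auto
      have "(\<Sum>R\<in>C. l R powr (p - 1)) = (\<Sum>a\<in>l ` C. a powr (p - 1))"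
        using inj by (simp add: sum.reindex)
      also have "\<dots> \<le> ?m powr (p - 1) / (1 - 2 powr - (p - 1))"
      proof (rule sum_powr_doubling)
        fix a b assume "a \<in> l ` C" "b \<in> l ` C" "a < b"
        then obtain R R' where R: "R \<in> C" "a = l R" "R' \<in> C" "b = l R'" by blast
        with \<open>a < b\<close> have "R \<noteq> R'" by auto
        with R \<open>a < b\<close> show "2 * a < b" using dbl[of R R'] l0[of R] by auto
      qed (use finC l0 p False in auto)
      also have "\<dots> = c * ?m powr (p - 1)" unfolding c_def by simp
      finally have "f x * (\<Sum>R\<in>C. l R powr (p - 1)) \<le> (c * f x) * ?m powr (p - 1)"
        using mult_left_mono[OF _ f(1)[of x]] by (fastforce simp: mult_ac)
      also have "\<dots> \<le> (c * f x) powr p / p + (1 - 1 / p) * ?m powr p"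
        using p c0 f(1) m0 by (intro Youngs_powr) auto
      \<comment> \<open>Enlarging the maximum to the full sum makes its integral equal to
        \<open>T\<close> again.\<close>
      also have "?m powr p \<le> (\<Sum>R\<in>C. l R powr p)"
      proof -
        obtain R where "R \<in> C" "?m = l R" using m by auto
        then show ?thesis using finC by (auto intro!: member_le_sum)
      qed
      finally show ?thesis unfolding L Rr using p c0 f(1)
        by (simp add: powr_mult mult_left_mono)
    qed
  qed
  have "T = (\<Sum>R\<in>S. l R powr (p - 1) * (LINT x:R|M. f x))"
    unfolding T_def
  proof (rule sum.cong[OF refl])
    fix R assume "R \<in> S"
    then have m: "0 < measure M R" using pos S(1) by auto
    have "l R powr p = l R powr (p - 1) * l R" using l0[of R] powr_add[of "l R" "p - 1" 1] by (cases "l R = 0") auto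
    then show "l R powr p * measure M R = l R powr (p - 1) * (LINT x:R|M. f x)"
      using m by (simp add: l_def)
  qed
  also have "\<dots> = (LINT x|M. (\<Sum>R\<in>S. l R powr (p - 1) * (indicator R x * f x)))"
    using intR by (subst Bochner_Integration.integral_sum) (auto simp: set_lebesgue_integral_def)
  also have "\<dots> \<le> (LINT x|M. c powr p * f x powr p / p + (1 - 1 / p) * (\<Sum>R\<in>S. indicator R x * l R powr p))"
    using intR intI f(3) by (intro integral_mono pw) auto
  also have "\<dots> = c powr p * I / p + (1 - 1 / p) * (\<Sum>R\<in>S. LINT x|M. indicator R x * l R powr p)"
    using intI f(3) unfolding I_def by (subst Bochner_Integration.integral_add) auto
  also have "(\<Sum>R\<in>S. LINT x|M. indicator R x * l R powr p) = T"
    unfolding T_def using S(1) F(3) by (intro sum.cong) (auto simp: mult.commute)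
  \<comment> \<open>\<open>T\<close> is a finite sum of reals, so \<open>(1 - 1 / p) * T\<close> may
    be subtracted from both sides.\<close>
  finally have "T / p \<le> c powr p * I / p" using p by (simp add: field_simps)
  then have "T \<le> c powr p * I" using p by (simp add: divide_le_cancel)
  then have "A * 2 powr p * T \<le> A * 2 powr p * (c powr p * I)"
    using A by (intro mult_left_mono) auto
  with 1 show ?thesis unfolding l_def I_def using c0 by (simp add: powr_mult mult.assoc)
qed

section \<open>Sparseness and entropy packing\<close>

lemma sum_indicator_disjoint:
  assumes "finite G" "disjoint G" "\<And>Q. Q \<in> G \<Longrightarrow> Q \<subseteq> R"
  shows "(\<Sum>Q\<in>G. indicator Q x) \<le> (indicator R x :: real)"
proof (cases "\<exists>Q\<in>G. x \<in> Q")
  case True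
  then obtain Q where Q: "Q \<in> G" "x \<in> Q" by blast
  have "(\<Sum>P\<in>G. indicator P x) = (indicator Q x :: real) + (\<Sum>P\<in>G-{Q}. indicator P x)"
    using assms Q by (simp add: sum.remove)
  also have "(\<Sum>P\<in>G-{Q}. indicator P x) = (0 :: real)"
    using assms(2) Q by (intro sum.neutral) (auto simp: disjoint_def indicator_def)
  finally have "(\<Sum>P\<in>G. indicator P x) = (1 :: real)" using Q by simp
  moreover have "x \<in> R" using assms(3) Q by blast
  ultimately show ?thesis by simp
next
  case False
  then have "(\<Sum>Q\<in>G. indicator Q x) = (0 :: real)" by (intro sum.neutral) auto
  then show ?thesis by simp
qed

lemma sum_set_integral_disjoint:
  fixes h :: "'a \<Rightarrow> real"
  assumes "finite G" "disjoint G" "G \<subseteq> sets M" "\<And>Q. Q \<in> G \<Longrightarrow> Q \<subseteq> R"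
    "\<And>x. 0 \<le> h x" "set_integrable M R h"
  shows "(\<Sum>Q\<in>G. LINT x:Q|M. h x) \<le> (LINT x:R|M. h x)"
proof -
  have int: "integrable M (\<lambda>x. indicator Q x * h x)" if "Q \<in> G" for Q
    using set_integrable_subset[OF assms(6), of Q] assms(3,4) that unfolding set_integrable_def by auto
  have "(\<Sum>Q\<in>G. LINT x:Q|M. h x) = (LINT x|M. (\<Sum>Q\<in>G. indicator Q x) * h x)"
    unfolding set_lebesgue_integral_def sum_distrib_right
    using int by (subst Bochner_Integration.integral_sum) auto
  also have "\<dots> \<le> (LINT x|M. indicator R x * h x)"
  proof (rule integral_mono)
    show "integrable M (\<lambda>x. (\<Sum>Q\<in>G. indicator Q x) * h x)"
      unfolding sum_distrib_right using int by (intro Bochner_Integration.integrable_sum) auto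
    show "integrable M (\<lambda>x. indicator R x * h x)" using assms(6) by (simp add: set_integrable_def)
  qed (intro mult_right_mono sum_indicator_disjoint assms)
  finally show ?thesis by (simp add: set_lebesgue_integral_def)
qed

lemma sum_measure_disjoint:
  assumes "finite G" "disjoint G" "G \<subseteq> sets M" "\<And>Q. Q \<in> G \<Longrightarrow> Q \<subseteq> R" "R \<in> sets M" "emeasure M R < \<infinity>"
  shows "(\<Sum>Q\<in>G. measure M Q) \<le> measure M R"
proof -
  have "(\<Sum>Q\<in>G. LINT x:Q|M. (1::real)) \<le> (LINT x:R|M. 1)"
    using assms by (intro sum_set_integral_disjoint) (auto simp: set_integrable_def)
  moreover have "(LINT x:Q|M. (1::real)) = measure M Q" if "Q \<in> sets M" for Q
    using that by (simp add: set_lebesgue_integral_def)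
  moreover have "Q \<in> sets M" if "Q \<in> G" for Q using that assms(3) by auto
  ultimately show ?thesis using assms(5) by simp
qed

text \<open>The maximal members strictly below \<open>R\<close> are disjoint and each has average
  more than \<open>2 * l R\<close>. So \<open>2 * l R\<close> times their total measure is at most
  the integral of \<open>h\<close> over \<open>R\<close>, which is \<open>l R * measure M R\<close>:
  they fill at most half of \<open>R\<close>.\<close>

lemma sparse_of_doubling:
  fixes h :: "'a \<Rightarrow> real" and M :: "'a measure"
  defines "l \<equiv> \<lambda>Q. (LINT x:Q|M. h x) / measure M Q"
  assumes S: "finite S" "laminar S" "S \<subseteq> sets M"
    and fin: "\<And>Q. Q \<in> S \<Longrightarrow> emeasure M Q < \<infinity>" and pos: "\<And>Q. Q \<in> S \<Longrightarrow> 0 < measure M Q"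
    and h: "\<And>x. 0 \<le> h x" "\<And>Q. Q \<in> S \<Longrightarrow> set_integrable M Q h"
    and dbl: "\<And>R R'. R \<in> S \<Longrightarrow> R' \<in> S \<Longrightarrow> R' \<subset> R \<Longrightarrow> 2 * l R < l R'"
    and R: "R \<in> S"
  shows "measure M R \<le> 2 * measure M (R - \<Union>{R'\<in>S. R' \<subset> R})"
proof -
  let ?C = "{R'\<in>S. R' \<subset> R}"
  have "finite ?C" "laminar ?C" using S(1) laminar_subset[OF S(2)] by auto
  from laminar_maximal[OF this] obtain G
    where G: "G \<subseteq> ?C" "disjoint G" "\<forall>Q\<in>?C. \<exists>R\<in>G. Q \<subseteq> R"
    by (elim exE conjE)
  have finG: "finite G" using G(1) S(1) by (auto intro: finite_subset)
  have l0: "0 \<le> l Q" for Q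
    unfolding l_def set_lebesgue_integral_def using h(1)
    by (intro divide_nonneg_nonneg integral_nonneg_AE) auto
  have U: "\<Union>?C = \<Union>G"
  proof
    show "\<Union>?C \<subseteq> \<Union>G"
    proof
      fix x assume "x \<in> \<Union>?C"
      then obtain Q where "Q \<in> ?C" "x \<in> Q" by (elim UnionE)
      with G(3) show "x \<in> \<Union>G" by (metis UnionI subsetD)
    qed
  qed (use G(1) in \<open>rule Union_mono\<close>)
  have mU: "\<Union>G \<in> sets M" using G(1) S finG by (intro sets.finite_Union) auto
  have RM: "R \<in> sets M" using R S by auto
  have UR: "\<Union>G \<subseteq> R" using G(1) by blast
  have "2 * measure M (\<Union>G) \<le> measure M R"
  proof (cases "G = {}")
    case False
    then obtain Q where "Q \<in> G" by blast
    have lm: "l Q * measure M Q = (LINT x:Q|M. h x)" if "Q \<in> S" for Q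
      using pos[OF that] by (simp add: l_def)
    have "(\<Sum>Q\<in>G. 2 * l R * measure M Q) \<le> (\<Sum>Q\<in>G. LINT x:Q|M. h x)"
    proof (rule sum_mono)
      fix Q assume "Q \<in> G"
      then have "Q \<in> S" "2 * l R < l Q" using G(1) dbl[OF R] by auto
      then show "2 * l R * measure M Q \<le> (LINT x:Q|M. h x)"
        using lm[of Q] by (metis less_imp_le measure_nonneg mult_right_mono)
    qed
    also have "\<dots> \<le> (LINT x:R|M. h x)"
      using G(1,2) S h R finG by (intro sum_set_integral_disjoint) auto
    also have "\<dots> = l R * measure M R" using lm[OF R] by simp
    finally have 1: "l R * (2 * (\<Sum>Q\<in>G. measure M Q)) \<le> l R * measure M R"
      by (simp add: sum_distrib_left mult_ac)
    \<comment> \<open>Needed to cancel \<open>l R\<close>. Were it zero, \<open>h\<close> would have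
      integral zero over \<open>R\<close>, and no subset could have an average exceeding
      \<open>2 * l R\<close>.\<close>
    have "0 < l R"
    proof (rule ccontr)
      assume "\<not> 0 < l R"
      then have "l R = 0" using l0[of R] by simp
      then have "(LINT x:R|M. h x) = 0" using lm[OF R] by simp
      moreover have "(LINT x:Q|M. h x) \<le> (LINT x:R|M. h x)"
      proof -
        have "(\<Sum>Q\<in>{Q}. LINT x:Q|M. h x) \<le> (LINT x:R|M. h x)"
          using G(1) S h R \<open>Q \<in> G\<close> by (intro sum_set_integral_disjoint) auto
        then show ?thesis by simp
      qed
      moreover have "Q \<in> S" "2 * l R < l Q" using \<open>Q \<in> G\<close> G(1) dbl[OF R] by auto
      ultimately show False using lm[of Q] pos[of Q] \<open>l R = 0\<close>
        by (metis mult_pos_pos mult_zero_right not_le)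
    qed
    with 1 have "2 * (\<Sum>Q\<in>G. measure M Q) \<le> measure M R" by simp
    moreover have "measure M (\<Union>G) \<le> (\<Sum>Q\<in>G. measure M Q)"
    proof -
      have "measure M (\<Union>Q\<in>G. Q) \<le> (\<Sum>Q\<in>G. measure M Q)"
        using finG G(1) S(3) by (intro measure_UNION_le) auto
      then show ?thesis by simp
    qed
    ultimately show ?thesis by simp
  qed simp
  moreover have "measure M (R - \<Union>G) = measure M R - measure M (\<Union>G)"
    using RM mU UR fin[OF R] by (intro measure_Diff) auto
  ultimately show ?thesis unfolding U by simp
qed

text \<open>On \<open>(2^j, 2^(j+1)]\<close> monotonicity bounds the integrand below by its value at
  the right end point, and the length \<open>2^j\<close> is half of that end point. Each interval
  thus contributes at least half of the term with index \<open>j + 1\<close>, so these terms add up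
  to at most \<open>2\<close>. The term with index \<open>0\<close> is not seen by this comparison
  and stays as \<open>\<epsilon> 1 powr - s\<close>.\<close>

lemma entropy_function_sum:
  assumes "entropy_function s \<epsilon>" "0 \<le> s"
  shows "(\<Sum>j<K. \<epsilon> (2 ^ j) powr - s) \<le> \<epsilon> 1 powr - s + 2"
proof -
  have pos: "\<And>t. 1 \<le> t \<Longrightarrow> 0 < \<epsilon> t" and mono: "mono_on {1..} \<epsilon>"
    and int: "(\<integral>\<^sup>+t\<in>{1..}. ennreal (1 / (t * \<epsilon> t powr s)) \<partial>lborel) = 1"
    using assms(1) unfolding entropy_function_def by auto
  define I :: "nat \<Rightarrow> real set" where "I j = {2 ^ j<..2 ^ Suc j}" for j
  define c where "c j = 1 / (2 ^ Suc j * \<epsilon> (2 ^ Suc j) powr s)" for j :: nat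
  have c0: "0 \<le> c j" for j unfolding c_def by simp
  have one: "1 \<le> (2 :: real) ^ j" for j by simp
  have pw: "(\<Sum>j<K. ennreal (c j) * indicator (I j) t) \<le> ennreal (1 / (t * \<epsilon> t powr s)) * indicator {1..} t" for t
  proof (cases "\<exists>j<K. t \<in> I j")
    case True
    then obtain j where j: "j < K" "t \<in> I j" by blast
    then have t: "2 ^ j < t" "t \<le> 2 ^ Suc j" "1 < t" using le_less_trans[OF one[of j], of t] unfolding I_def by auto
    \<comment> \<open>The intervals \<open>I j\<close> are half-open, hence disjoint: at each point
      at most one term of the step function survives.\<close>
    have uniq: "i = j" if "t \<in> I i" for i
    proof -
      have "(2 :: real) ^ i < 2 ^ Suc j" "(2 :: real) ^ j < 2 ^ Suc i" using that t unfolding I_def by auto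
      then have "i < Suc j" "j < Suc i" by (metis power_less_imp_less_exp one_less_numeral_iff semiring_norm(76))+
      then show ?thesis by simp
    qed
    have "(\<Sum>j<K. ennreal (c j) * indicator (I j) t) = (\<Sum>i\<in>{j}. ennreal (c i) * indicator (I i) t)"
    proof (rule sum.mono_neutral_right)
      show "\<forall>i\<in>{..<K} - {j}. ennreal (c i) * indicator (I i) t = 0"
        using uniq by (metis DiffD2 indicator_simps(2) mult_zero_right singletonI)
    qed (use j in auto)
    also have "\<dots> = ennreal (c j)" using j by simp
    also have "c j \<le> 1 / (t * \<epsilon> t powr s)"
      unfolding c_def
    proof (intro divide_left_mono mult_mono powr_mono2 mult_pos_pos)
      show "\<epsilon> t \<le> \<epsilon> (2 ^ Suc j)"
        using t one[of "Suc j"] by (intro mono_onD[OF mono]) auto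
      show "0 < \<epsilon> t powr s" using pos[of t] t by simp
    qed (use t pos[of t] pos[of "2 ^ Suc j"] one[of "Suc j"] assms(2) in auto)
    finally show ?thesis using t by (simp add: ennreal_leI)
  next
    case False
    then have "(\<Sum>j<K. ennreal (c j) * indicator (I j) t) = 0" by (intro sum.neutral) auto
    then show ?thesis by simp
  qed
  have cj: "c j * 2 ^ j = \<epsilon> (2 ^ Suc j) powr - s / 2" for j
    unfolding c_def by (simp add: powr_minus field_simps)
  have "ennreal (\<Sum>j<K. \<epsilon> (2 ^ Suc j) powr - s / 2) = (\<Sum>j<K. ennreal (c j) * emeasure lborel (I j))"
    using c0 by (subst sum_ennreal[symmetric]) (auto simp: I_def ennreal_mult[symmetric] cj intro!: sum.cong)
  also have "\<dots> = (\<integral>\<^sup>+t. (\<Sum>j<K. ennreal (c j) * indicator (I j) t) \<partial>lborel)"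
    by (subst nn_integral_sum) (auto simp: I_def nn_integral_cmult_indicator)
  also have "\<dots> \<le> (\<integral>\<^sup>+t\<in>{1..}. ennreal (1 / (t * \<epsilon> t powr s)) \<partial>lborel)"
    by (intro nn_integral_mono pw)
  also have "\<dots> = ennreal 1" using int by simp
  finally have "(\<Sum>j<K. \<epsilon> (2 ^ Suc j) powr - s / 2) \<le> 1"
    by (subst (asm) ennreal_le_iff) auto
  then have 1: "(\<Sum>j<K. \<epsilon> (2 ^ Suc j) powr - s) \<le> 2" by (simp add: sum_divide_distrib[symmetric])
  have "(\<Sum>j<K. \<epsilon> (2 ^ j) powr - s) \<le> (\<Sum>j<Suc K. \<epsilon> (2 ^ j) powr - s)" by simp
  also have "\<dots> = \<epsilon> 1 powr - s + (\<Sum>j<K. \<epsilon> (2 ^ Suc j) powr - s)"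
    by (subst sum.lessThan_Suc_shift) simp
  finally show ?thesis using 1 by simp
qed

text \<open>The packing factor \<open>2 * r Q\<close> varies with the cube. Within a layer
  \<open>2^j \<le> r < 2^(j+1)\<close> it is at most \<open>4 * 2^j\<close>, and the disjoint
  maximal cubes of the layer carry at most the mass of \<open>R\<close>. The denominator is at least
  \<open>2^j * \<epsilon> (2^j) powr s\<close> there, so \<open>2^j\<close> cancels and the layers
  add up to the series of \<open>entropy_function_sum\<close>.\<close>

lemma entropy_packing:
  fixes m r :: "'a set \<Rightarrow> real"
  assumes ent: "entropy_function s \<epsilon>" "0 \<le> s"
    and F: "finite F" "laminar F" and r: "\<And>Q. Q \<in> F \<Longrightarrow> 1 \<le> r Q" and m: "\<And>Q. Q \<in> F \<Longrightarrow> 0 \<le> m Q"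
    and pack: "\<And>Q. Q \<in> F \<Longrightarrow> (\<Sum>P\<in>{P\<in>F. P \<subseteq> Q}. m P) \<le> 2 * r Q * m Q"
    and sub: "\<And>G R. G \<subseteq> F \<Longrightarrow> disjoint G \<Longrightarrow> R \<in> F \<Longrightarrow> (\<And>Q. Q \<in> G \<Longrightarrow> Q \<subseteq> R) \<Longrightarrow> sum m G \<le> m R"
    and R: "R \<in> F"
  shows "(\<Sum>Q\<in>{Q\<in>F. Q \<subseteq> R}. m Q / (r Q * \<epsilon> (r Q) powr s)) \<le> 4 * (\<epsilon> 1 powr - s + 2) * m R"
proof -
  have pos: "\<And>t. 1 \<le> t \<Longrightarrow> 0 < \<epsilon> t" and mono: "mono_on {1..} \<epsilon>"
    using ent(1) unfolding entropy_function_def by auto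
  define k where "k Q = nat \<lfloor>log 2 (r Q)\<rfloor>" for Q
  have k: "2 ^ k Q \<le> r Q" "r Q < 2 ^ Suc (k Q)" if "Q \<in> F" for Q
  proof -
    have l: "0 \<le> log 2 (r Q)" using r[OF that] by simp
    have "real (k Q) \<le> log 2 (r Q)" "log 2 (r Q) < real (Suc (k Q))"
      unfolding k_def using l by linarith+
    then show "2 ^ k Q \<le> r Q" "r Q < 2 ^ Suc (k Q)"
      using r[OF that] by (simp_all add: le_log_iff log_less_iff powr_realpow powr_add)
  qed
  define H where "H j = {Q\<in>{Q\<in>F. Q \<subseteq> R}. k Q = j}" for j
  \<comment> \<open>Only finitely many layers occur, and the bound on the series does not depend on
    how many.\<close>
  define K where "K = Suc (Max (k ` F))"
  have kK: "k Q < K" if "Q \<in> F" for Q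
    unfolding K_def using F(1) that by (simp add: less_Suc_eq_le)
  have layer: "(\<Sum>Q\<in>H j. m Q / (r Q * \<epsilon> (r Q) powr s)) \<le> 4 * m R * \<epsilon> (2 ^ j) powr - s" for j
  proof -
    have one: "1 \<le> (2 :: real) ^ j" by simp
    have HF: "H j \<subseteq> F" unfolding H_def by blast
    have finH: "finite (H j)" using HF F(1) finite_subset by blast
    obtain G where G: "G \<subseteq> H j" "disjoint G" "\<forall>Q\<in>H j. \<exists>P\<in>G. Q \<subseteq> P"
      using laminar_maximal[OF finH laminar_subset[OF F(2) HF]] by (elim exE conjE)
    have finG: "finite G" using G(1) finH finite_subset by blast
    have "(\<Sum>Q\<in>H j. m Q / (r Q * \<epsilon> (r Q) powr s)) \<le> (\<Sum>Q\<in>H j. m Q / (2 ^ j * \<epsilon> (2 ^ j) powr s))"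
    proof (rule sum_mono)
      fix Q assume "Q \<in> H j"
      then have Q: "Q \<in> F" "2 ^ j \<le> r Q" using k unfolding H_def by auto
      have "\<epsilon> (2 ^ j) powr s \<le> \<epsilon> (r Q) powr s"
        using Q one r[of Q] pos[OF one] ent(2) by (intro powr_mono2 mono_onD[OF mono]) auto
      then show "m Q / (r Q * \<epsilon> (r Q) powr s) \<le> m Q / (2 ^ j * \<epsilon> (2 ^ j) powr s)"
        using Q m[of Q] r[of Q] pos[OF one] pos[of "r Q"]
        by (intro divide_left_mono mult_mono mult_pos_pos) auto
    qed
    also have "\<dots> = (\<Sum>Q\<in>H j. m Q) / (2 ^ j * \<epsilon> (2 ^ j) powr s)" by (simp add: sum_divide_distrib)
    also have "(\<Sum>Q\<in>H j. m Q) \<le> 4 * 2 ^ j * m R"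
    proof -
      have "(\<Sum>Q\<in>H j. m Q) \<le> (\<Sum>Q\<in>H j. \<Sum>P\<in>G. if Q \<subseteq> P then m Q else 0)"
      proof (rule sum_mono)
        fix Q assume Q: "Q \<in> H j"
        then obtain P where P: "P \<in> G" "Q \<subseteq> P" using G(3) by blast
        have "m Q = (\<Sum>P\<in>{P}. if Q \<subseteq> P then m Q else 0)" using P by simp
        also have "\<dots> \<le> (\<Sum>P\<in>G. if Q \<subseteq> P then m Q else 0)"
          using finG P m Q HF by (intro sum_mono2) auto
        finally show "m Q \<le> \<dots>" .
      qed
      also have "\<dots> = (\<Sum>P\<in>G. \<Sum>Q\<in>H j. if Q \<subseteq> P then m Q else 0)" by (rule sum.swap)
      also have "\<dots> \<le> (\<Sum>P\<in>G. \<Sum>Q\<in>{Q\<in>F. Q \<subseteq> P}. m Q)"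
        unfolding sum.inter_filter[OF finH, symmetric]
        using F(1) HF m by (intro sum_mono sum_mono2) auto
      also have "\<dots> \<le> (\<Sum>P\<in>G. 4 * 2 ^ j * m P)"
      proof (rule sum_mono)
        fix P assume "P \<in> G"
        then have P: "P \<in> F" "k P = j" using G(1) unfolding H_def by auto
        have "(\<Sum>Q\<in>{Q\<in>F. Q \<subseteq> P}. m Q) \<le> 2 * r P * m P" using pack P by auto
        also have "\<dots> \<le> 4 * 2 ^ j * m P"
          using k[OF P(1)] P(2) m[OF P(1)] by (intro mult_right_mono) auto
        finally show "(\<Sum>Q\<in>{Q\<in>F. Q \<subseteq> P}. m Q) \<le> 4 * 2 ^ j * m P" .
      qed
      also have "\<dots> = 4 * 2 ^ j * sum m G" by (simp add: sum_distrib_left)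
      also have "sum m G \<le> m R"
        using G HF R unfolding H_def by (intro sub) auto
      finally show ?thesis by simp
    qed
    finally have "(\<Sum>Q\<in>H j. m Q / (r Q * \<epsilon> (r Q) powr s)) \<le> 4 * 2 ^ j * m R / (2 ^ j * \<epsilon> (2 ^ j) powr s)"
      by (simp add: divide_right_mono)
    also have "\<dots> = 4 * m R * \<epsilon> (2 ^ j) powr - s"
      using pos[OF one] by (simp add: powr_minus field_simps)
    finally show ?thesis .
  qed
  have "(\<Sum>Q\<in>{Q\<in>F. Q \<subseteq> R}. m Q / (r Q * \<epsilon> (r Q) powr s))
      = (\<Sum>j<K. \<Sum>Q\<in>H j. m Q / (r Q * \<epsilon> (r Q) powr s))"
    unfolding H_def using F(1) kK by (intro sum.group[symmetric]) auto
  also have "\<dots> \<le> (\<Sum>j<K. 4 * m R * \<epsilon> (2 ^ j) powr - s)" by (intro sum_mono layer)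
  also have "\<dots> = 4 * m R * (\<Sum>j<K. \<epsilon> (2 ^ j) powr - s)" by (simp add: sum_distrib_left)
  also have "\<dots> \<le> 4 * m R * (\<epsilon> 1 powr - s + 2)"
    using entropy_function_sum[OF ent] m[OF R] by (intro mult_left_mono) auto
  finally show ?thesis by (simp add: mult_ac)
qed

section \<open>Shifted dyadic grids\<close>

text \<open>Generations \<open>k\<close> and \<open>k + 1\<close> are nested because twice the shift at level \<open>k\<close> differs from the
  shift at level \<open>k + 1\<close> by an integer; hence the alternation of \<open>1/3\<close> and \<open>2/3\<close>.\<close>

definition dyadic_shift :: "'n set \<Rightarrow> int \<Rightarrow> 'n \<Rightarrow> real" where
  "dyadic_shift A k i = (if i \<in> A then if even k then 1 / 3 else 2 / 3 else 0)"

definition dyadic_cell :: "'n set \<Rightarrow> int \<Rightarrow> real ^ 'n \<Rightarrow> 'n \<Rightarrow> int" where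
  "dyadic_cell A k x i = \<lfloor>2 powr k * x $ i + dyadic_shift A k i\<rfloor>"

text \<open>Fibres of the cell map are half-open cubes of side \<open>2 powr - k\<close>: larger
  \<open>k\<close> means smaller cubes, and cubes of one generation are disjoint by
  construction.\<close>

definition dyadic_cube :: "'n set \<Rightarrow> int \<Rightarrow> ('n \<Rightarrow> int) \<Rightarrow> (real ^ 'n) set" where
  "dyadic_cube A k m = {x. dyadic_cell A k x = m}"

definition dyadic_grid :: "'n set \<Rightarrow> (real ^ 'n) set set" where
  "dyadic_grid A = {dyadic_cube A k m | k m. True}"

text \<open>The coarser cell is a function of the finer one: halving commutes with taking floors up
  to an integer correction from the shifts, so agreement of cells at level \<open>k\<close> passes
  to level \<open>k - 1\<close>.\<close>

lemma dyadic_cell_coarser: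
  assumes "dyadic_cell A l x = dyadic_cell A l y" "k \<le> l"
  shows "dyadic_cell A k x = dyadic_cell A k y"
  using assms(2,1)
proof (induction k rule: int_le_induct)
  case (step k)
  have eq: "dyadic_cell A (k - 1) x i = (dyadic_cell A k x i - (if i \<in> A \<and> even k then - 1 else 0)) div 2" for x i
  proof -
    \<comment> \<open>For even \<open>k\<close> the shift goes from \<open>1/3\<close> to
      \<open>2/3\<close>, and \<open>2 * 2/3 = 1/3 + 1\<close>; for odd \<open>k\<close> it goes
      from \<open>2/3\<close> to \<open>1/3\<close>, where doubling matches exactly.\<close>
    define z :: int where "z = (if i \<in> A \<and> even k then - 1 else 0)"
    have z: "2 * dyadic_shift A (k - 1) i = dyadic_shift A k i - z"
      by (auto simp: dyadic_shift_def z_def)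
    have "2 powr k = 2 * 2 powr (k - 1)" by (simp add: powr_diff)
    then have "2 powr (k - 1) * x $ i + dyadic_shift A (k - 1) i
        = (2 powr k * x $ i + dyadic_shift A k i - z) / real_of_int 2"
      using z by (simp add: field_simps)
    then have "dyadic_cell A (k - 1) x i = \<lfloor>(2 powr k * x $ i + dyadic_shift A k i - z) / real_of_int 2\<rfloor>"
      unfolding dyadic_cell_def by (rule arg_cong)
    also have "\<dots> = \<lfloor>2 powr k * x $ i + dyadic_shift A k i - z\<rfloor> div 2"
      by (rule floor_divide_real_eq_div) simp
    also have "\<lfloor>2 powr k * x $ i + dyadic_shift A k i - z\<rfloor> = dyadic_cell A k x i - z"
      unfolding dyadic_cell_def by simp
    finally show ?thesis by (simp only: z_def)
  qed
  show ?case using step by (intro ext) (simp add: eq)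
qed simp

lemma dyadic_cube_nested:
  assumes "k \<le> l" "dyadic_cube A k m \<inter> dyadic_cube A l m' \<noteq> {}"
  shows "dyadic_cube A l m' \<subseteq> dyadic_cube A k m"
proof
  fix y assume "y \<in> dyadic_cube A l m'"
  moreover obtain x where "x \<in> dyadic_cube A k m" "x \<in> dyadic_cube A l m'" using assms(2) by blast
  ultimately show "y \<in> dyadic_cube A k m"
    using dyadic_cell_coarser[of A l x y k] assms(1) by (simp add: dyadic_cube_def)
qed

lemma laminar_dyadic_grid: "laminar (dyadic_grid A)"
  unfolding laminar_def
proof (intro ballI)
  fix P Q assume "P \<in> dyadic_grid A" "Q \<in> dyadic_grid A"
  then obtain k m l m' where PQ: "P = dyadic_cube A k m" "Q = dyadic_cube A l m'"
    by (auto simp: dyadic_grid_def)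
  show "P \<subseteq> Q \<or> Q \<subseteq> P \<or> P \<inter> Q = {}"
  proof (cases "k \<le> l")
    case True
    then show ?thesis using dyadic_cube_nested[of k l A m m'] unfolding PQ by argo
  next
    case False
    then have "l \<le> k" by simp
    then show ?thesis using dyadic_cube_nested[of l k A m' m] unfolding PQ by (metis Int_commute)
  qed
qed

text \<open>The half-open cube lies between the open and the closed box with the same corners;
  volume, closure and boundary are read off from those two.\<close>

lemma dyadic_cube_cbox:
  fixes A :: "'n::finite set" and k :: int
  defines "r \<equiv> 2 powr - real_of_int k"
  obtains a where "box a (a + vec r) \<subseteq> dyadic_cube A k m" "dyadic_cube A k m \<subseteq> cbox a (a + vec r)"
proof
  define a :: "real ^ 'n" where "a = (\<chi> i. (m i - dyadic_shift A k i) * r)"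
  have p: "2 powr real_of_int k * r = 1" "0 < r" "0 < 2 powr real_of_int k"
    unfolding r_def by (simp_all flip: powr_add)
  have eq: "dyadic_cell A k x i = m i \<longleftrightarrow> a $ i \<le> x $ i \<and> x $ i < a $ i + r" for x i
  proof -
    let ?X = "2 powr real_of_int k * x $ i"
    have x: "x $ i = ?X * r" using p(1) by (simp add: mult_ac)
    have "dyadic_cell A k x i = m i \<longleftrightarrow> m i - dyadic_shift A k i \<le> ?X \<and> ?X < m i - dyadic_shift A k i + 1"
      unfolding dyadic_cell_def floor_eq_iff by auto
    also have "\<dots> \<longleftrightarrow> (m i - dyadic_shift A k i) * r \<le> ?X * r \<and> ?X * r < (m i - dyadic_shift A k i + 1) * r"
      using p(2) by simp
    finally show ?thesis unfolding a_def x[symmetric] by (simp add: algebra_simps)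
  qed
  have "dyadic_cube A k m = {x. \<forall>i. a $ i \<le> x $ i \<and> x $ i < a $ i + r}"
    unfolding dyadic_cube_def fun_eq_iff eq ..
  then show "box a (a + vec r) \<subseteq> dyadic_cube A k m" "dyadic_cube A k m \<subseteq> cbox a (a + vec r)"
    by (auto simp: mem_box_cart less_eq_real_def)
qed

text \<open>The bracket is a supremum over closed cubes, while the grids consist of half-open ones.
  A grid cube differs from its closure by part of the boundary of a box, which is a null set, so the
  two can be exchanged in every integral.\<close>

lemma
  fixes A :: "'n::finite set"
  shows measure_dyadic_cube: "measure lebesgue (dyadic_cube A k m) = (2 powr - real_of_int k) ^ CARD('n)"
    and fmeasurable_dyadic_cube: "dyadic_cube A k m \<in> lmeasurable"
    and closure_dyadic_cube: "closure (dyadic_cube A k m) \<in> cubes"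
    and negligible_closure_dyadic_cube: "negligible (closure (dyadic_cube A k m) - dyadic_cube A k m)"
proof -
  define r where "r = 2 powr - real_of_int k"
  have r: "0 < r" unfolding r_def by simp
  obtain a where a: "box a (a + vec r) \<subseteq> dyadic_cube A k m" "dyadic_cube A k m \<subseteq> cbox a (a + vec r)"
    using dyadic_cube_cbox[of k A m] unfolding r_def by metis
  have ne: "box a (a + vec r) \<noteq> {}"
    using r by (simp add: interval_ne_empty_cart)
  have 1: "dyadic_cube A k m \<in> sets borel"
  proof -
    have "dyadic_cube A k m = {x. \<forall>i. real_of_int (m i) \<le> 2 powr k * x $ i + dyadic_shift A k i
        \<and> 2 powr k * x $ i + dyadic_shift A k i < real_of_int (m i) + 1}"
      unfolding dyadic_cube_def fun_eq_iff dyadic_cell_def floor_eq_iff ..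
    also have "\<dots> \<in> sets borel" by measurable
    finally show ?thesis .
  qed
  have cl: "closure (dyadic_cube A k m) = cbox a (a + vec r)"
    using closure_mono[OF a(1)] closure_mono[OF a(2)] closure_box[OF ne] by auto
  show "closure (dyadic_cube A k m) \<in> cubes"
    unfolding cl cubes_def using r by blast
  show 2: "negligible (closure (dyadic_cube A k m) - dyadic_cube A k m)"
    unfolding cl using a(1) by (intro negligible_subset[OF negligible_frontier_interval]) blast
  have 3: "dyadic_cube A k m \<in> sets lebesgue" using 1 by auto
  then show 4: "dyadic_cube A k m \<in> lmeasurable"
    using a(2) by (intro bounded_set_imp_lmeasurable) (auto intro: bounded_subset[OF bounded_cbox])
  have "measure lebesgue (dyadic_cube A k m) = measure lebesgue (cbox a (a + vec r))"
    using a(2) 2 4 unfolding cl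
    by (intro measure_negligible_symdiff) (auto simp: Un_absorb2 intro: negligible_subset)
  also have "\<dots> = r ^ CARD('n)"
    using ne box_subset_cbox[of a "a + vec r"] content_cbox_cart[of a "a + vec r"] by auto
  finally show "measure lebesgue (dyadic_cube A k m) = (2 powr - real_of_int k) ^ CARD('n)"
    by (simp only: r_def)
qed

lemma countable_dyadic_grid: "countable (dyadic_grid (A :: 'n::finite set))"
proof -
  have "dyadic_grid A = range (\<lambda>(k, m). dyadic_cube A k (\<lambda>i. m $ i))"
    unfolding dyadic_grid_def
  proof safe
    fix k and m :: "'n \<Rightarrow> int"
    show "dyadic_cube A k m \<in> range (\<lambda>(k, m). dyadic_cube A k (\<lambda>i. m $ i))"
      by (rule range_eqI[of _ _ "(k, \<chi> i. m i)"]) (simp add: vec_lambda_inverse)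
  qed blast
  then show ?thesis by simp
qed

section \<open>The one-third trick\<close>

lemma floor_third_shift:
  fixes u v :: real
  assumes "\<bar>u - v\<bar> < 1 / 3" "\<lfloor>u\<rfloor> \<noteq> \<lfloor>v\<rfloor>"
  shows "\<lfloor>u + 1 / 3\<rfloor> = \<lfloor>v + 1 / 3\<rfloor>" "\<lfloor>u + 2 / 3\<rfloor> = \<lfloor>v + 2 / 3\<rfloor>"
proof -
  \<comment> \<open>If the integer \<open>m\<close> is the floor of \<open>b\<close>, then
    \<open>a\<close> lies in \<open>(m - 1/3, m)\<close> and \<open>b\<close> in
    \<open>[m, m + 1/3)\<close>, and moving both by \<open>1/3\<close> or by \<open>2/3\<close> puts
    them into \<open>[m, m + 1)\<close>. Both shifts are treated because the grids alternate between
    them.\<close>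
  have *: "\<lfloor>a + 1 / 3\<rfloor> = \<lfloor>b\<rfloor> \<and> \<lfloor>b + 1 / 3\<rfloor> = \<lfloor>b\<rfloor> \<and> \<lfloor>a + 2 / 3\<rfloor> = \<lfloor>b\<rfloor> \<and> \<lfloor>b + 2 / 3\<rfloor> = \<lfloor>b\<rfloor>"
    if "\<lfloor>a\<rfloor> < \<lfloor>b\<rfloor>" "b - a < 1 / 3" for a b :: real
    unfolding floor_eq_iff using that by linarith
  show "\<lfloor>u + 1 / 3\<rfloor> = \<lfloor>v + 1 / 3\<rfloor>" "\<lfloor>u + 2 / 3\<rfloor> = \<lfloor>v + 2 / 3\<rfloor>"
    using *[of u v] *[of v u] assms unfolding abs_less_iff neq_iff minus_diff_eq by argo+
qed

text \<open>The one-third trick: shift exactly those coordinates in which the unshifted grid separates the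
  two points.\<close>

lemma common_dyadic_cube:
  fixes x y :: "real ^ 'n::finite"
  assumes "x \<noteq> y"
  obtains A k m where "x \<in> dyadic_cube A k m" "y \<in> dyadic_cube A k m" "2 powr - real_of_int k \<le> 6 * norm (y - x)"
proof -
  define d where "d = norm (y - x)"
  have d: "0 < d" using assms unfolding d_def by simp
  \<comment> \<open>Chosen so that the side \<open>2 powr - k\<close> lies in
    \<open>(3 * d, 6 * d]\<close>: the lower bound makes the rescaled coordinates differ by less
    than \<open>1/3\<close>, the upper bound is the \<open>6\<close> of the statement.\<close>
  define k where "k = - (\<lfloor>log 2 (3 * d)\<rfloor> + 1)"
  have k: "log 2 (3 * d) < - real_of_int k" "- real_of_int k \<le> log 2 (3 * d) + 1"
    unfolding k_def by linarith+
  have k1: "3 * d < 2 powr - real_of_int k"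
    using k(1) d by (subst (asm) log_less_iff) auto
  have "2 powr - real_of_int k \<le> 2 powr (log 2 (3 * d) + 1)"
    using k(2) by (intro powr_mono) auto
  then have k2: "2 powr - real_of_int k \<le> 6 * d" using d by (simp add: powr_add)
  have close: "\<bar>2 powr k * x $ i - 2 powr k * y $ i\<bar> < 1 / 3" for i
  proof -
    have "\<bar>2 powr k * x $ i - 2 powr k * y $ i\<bar> = 2 powr k * \<bar>(y - x) $ i\<bar>"
      by (simp add: abs_mult abs_minus_commute flip: right_diff_distrib)
    also have "\<dots> \<le> 2 powr k * d"
      unfolding d_def by (intro mult_left_mono component_le_norm_cart) auto
    also have "\<dots> < 2 powr k * (2 powr - real_of_int k / 3)"
      using k1 by (intro mult_strict_left_mono) auto
    also have "\<dots> = 1 / 3" by (simp flip: powr_add)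
    finally show ?thesis .
  qed
  define A where "A = {i. \<lfloor>2 powr k * x $ i\<rfloor> \<noteq> \<lfloor>2 powr k * y $ i\<rfloor>}"
  have "dyadic_cell A k x = dyadic_cell A k y"
    using floor_third_shift[OF close]
    by (intro ext) (auto simp: dyadic_cell_def dyadic_shift_def A_def)
  then show ?thesis using that[of A k "dyadic_cell A k x"] k2 unfolding dyadic_cube_def d_def by auto
qed

text \<open>The \<open>i\<close>-th generation inside \<open>S\<close> consists of disjoint cubes,
  so \<open>g\<close> sums to at most \<open>g S\<close> over it, while the volume factor has shrunk
  by \<open>2 powr (- \<alpha> * i)\<close>. The geometric series converges because
  \<open>\<alpha> > 0\<close> and yields the constant.\<close>

lemma dyadic_generations_sum:
  fixes A :: "'n::finite set" and g :: "(real ^ 'n) set \<Rightarrow> real"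
  assumes "0 < \<alpha>" and F: "finite F" "F \<subseteq> dyadic_grid A" and S: "S \<in> dyadic_grid A" and g0: "\<And>Q. 0 \<le> g Q"
    and sub: "\<And>G. finite G \<Longrightarrow> G \<subseteq> dyadic_grid A \<Longrightarrow> disjoint G \<Longrightarrow> (\<And>Q. Q \<in> G \<Longrightarrow> Q \<subseteq> S) \<Longrightarrow> sum g G \<le> g S"
  shows "(\<Sum>Q\<in>{Q\<in>F. Q \<subseteq> S}. measure lebesgue Q powr (\<alpha> / real CARD('n)) * g Q)
    \<le> 1 / (1 - 2 powr - \<alpha>) * (measure lebesgue S powr (\<alpha> / real CARD('n)) * g S)"
proof -
  have "\<exists>k m. Q = dyadic_cube A k m" if "Q \<in> dyadic_grid A" for Q using that unfolding dyadic_grid_def by auto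
  then obtain k m where km: "\<And>Q. Q \<in> dyadic_grid A \<Longrightarrow> Q = dyadic_cube A (k Q) (m Q)" by metis
  have size: "measure lebesgue Q powr (\<alpha> / real CARD('n)) = 2 powr (- \<alpha> * k Q)" if "Q \<in> dyadic_grid A" for Q
  proof -
    have "measure lebesgue Q = (2 powr - real_of_int (k Q)) ^ CARD('n)"
      using km[OF that] measure_dyadic_cube by metis
    then show ?thesis by (simp add: powr_powr mult_ac flip: powr_realpow)
  qed
  \<comment> \<open>The generation of a cube is determined by its volume, so inclusion compares
    generations. This makes \<open>nat (k Q - k S)\<close> a true difference.\<close>
  have kS: "k S \<le> k Q" if "Q \<in> dyadic_grid A" "Q \<subseteq> S" for Q
  proof -
    have "Q \<in> lmeasurable" "S \<in> lmeasurable"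
      using fmeasurable_dyadic_cube[of A "k Q" "m Q"] fmeasurable_dyadic_cube[of A "k S" "m S"]
        km[OF that(1)] km[OF S] by simp_all
    then have "measure lebesgue Q \<le> measure lebesgue S"
      using that(2) by (intro measure_mono_fmeasurable fmeasurableD)
    then have "measure lebesgue Q powr (\<alpha> / real CARD('n)) \<le> measure lebesgue S powr (\<alpha> / real CARD('n))"
      using \<open>0 < \<alpha>\<close> by (intro powr_mono2) auto
    then show ?thesis using \<open>0 < \<alpha>\<close> size[OF that(1)] size[OF S] by simp
  qed
  define j where "j Q = nat (k Q - k S)" for Q
  define K where "K = Suc (Max (j ` F))"
  have jK: "j Q < K" if "Q \<in> F" for Q
    unfolding K_def using F(1) that by (simp add: less_Suc_eq_le)
  define H where "H i = {Q\<in>{Q\<in>F. Q \<subseteq> S}. j Q = i}" for i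
  define b where "b = 2 powr - \<alpha>"
  have b: "0 < b" "b < 1" using \<open>0 < \<alpha>\<close> unfolding b_def by (auto simp: powr_less_one)
  have layer: "(\<Sum>Q\<in>H i. measure lebesgue Q powr (\<alpha> / real CARD('n)) * g Q)
      \<le> measure lebesgue S powr (\<alpha> / real CARD('n)) * g S * b ^ i" for i
  proof -
    have kk: "k Q = k S + int i" if "Q \<in> H i" for Q
      using that kS[of Q] F(2) unfolding H_def j_def by auto
    have "(\<Sum>Q\<in>H i. measure lebesgue Q powr (\<alpha> / real CARD('n)) * g Q)
      = (\<Sum>Q\<in>H i. measure lebesgue S powr (\<alpha> / real CARD('n)) * b ^ i * g Q)"
    proof (rule sum.cong[OF refl])
      fix Q assume Q: "Q \<in> H i"
      then have "Q \<in> dyadic_grid A" using F(2) unfolding H_def by auto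
      then have "measure lebesgue Q powr (\<alpha> / real CARD('n)) = 2 powr (- \<alpha> * k S + (- \<alpha>) * real i)"
        using size kk[OF Q] by (simp add: algebra_simps)
      also have "\<dots> = 2 powr (- \<alpha> * k S) * b ^ i"
      proof -
        have "b ^ i = 2 powr (- \<alpha> * real i)"
          unfolding b_def by (simp add: powr_powr flip: powr_realpow)
        then show ?thesis by (simp only: powr_add)
      qed
      finally show "measure lebesgue Q powr (\<alpha> / real CARD('n)) * g Q
          = measure lebesgue S powr (\<alpha> / real CARD('n)) * b ^ i * g Q"
        using size[OF S] by simp
    qed
    also have "\<dots> = measure lebesgue S powr (\<alpha> / real CARD('n)) * b ^ i * sum g (H i)"
      by (simp add: sum_distrib_left)
    finally have eq: "(\<Sum>Q\<in>H i. measure lebesgue Q powr (\<alpha> / real CARD('n)) * g Q)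
        = measure lebesgue S powr (\<alpha> / real CARD('n)) * b ^ i * sum g (H i)" .
    have "sum g (H i) \<le> g S"
    proof (rule sub)
      show "disjoint (H i)"
      proof (rule disjointI)
        fix P Q assume PQ: "P \<in> H i" "Q \<in> H i" "P \<noteq> Q"
        then have "P = dyadic_cube A (k S + int i) (m P)" "Q = dyadic_cube A (k S + int i) (m Q)"
          using km kk F(2) unfolding H_def by (metis (no_types, lifting) mem_Collect_eq subsetD)+
        then show "P \<inter> Q = {}" using PQ(3) by (metis (mono_tags, lifting) disjoint_iff dyadic_cube_def mem_Collect_eq)
      qed
    qed (use F in \<open>auto simp: H_def\<close>)
    then have "measure lebesgue S powr (\<alpha> / real CARD('n)) * b ^ i * sum g (H i)
        \<le> measure lebesgue S powr (\<alpha> / real CARD('n)) * b ^ i * g S"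
      using b by (intro mult_left_mono) auto
    then show ?thesis unfolding eq by (simp add: mult_ac)
  qed
  have "(\<Sum>Q\<in>{Q\<in>F. Q \<subseteq> S}. measure lebesgue Q powr (\<alpha> / real CARD('n)) * g Q)
      = (\<Sum>i<K. \<Sum>Q\<in>H i. measure lebesgue Q powr (\<alpha> / real CARD('n)) * g Q)"
    unfolding H_def using F(1) jK by (intro sum.group[symmetric]) auto
  also have "\<dots> \<le> (\<Sum>i<K. measure lebesgue S powr (\<alpha> / real CARD('n)) * g S * b ^ i)"
    by (intro sum_mono layer)
  also have "\<dots> = measure lebesgue S powr (\<alpha> / real CARD('n)) * g S * (\<Sum>i<K. b ^ i)"
    by (simp add: sum_distrib_left)
  also have "(\<Sum>i<K. b ^ i) \<le> 1 / (1 - b)"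
    using b by (simp add: sum_gp_strict divide_right_mono)
  finally show ?thesis using g0[of S] unfolding b_def by (simp add: mult_left_mono)
qed

section \<open>Weights on dyadic cubes\<close>

text \<open>Local integrability gives measurability on each ball; the weight is the pointwise limit
  of its restrictions to growing balls.\<close>

lemma borel_measurable_weight:
  fixes \<mu> :: "real ^ 'n \<Rightarrow> real"
  assumes "is_weight \<mu>"
  shows "\<mu> \<in> borel_measurable lebesgue"
proof (rule borel_measurable_LIMSEQ_real)
  show "(\<lambda>x. indicator (cball 0 (real i)) x * \<mu> x) \<in> borel_measurable lebesgue" for i
  proof -
    have "set_integrable lebesgue (cball 0 (real i)) \<mu>"
      using assms unfolding is_weight_def by (metis compact_cball)
    then show ?thesis unfolding set_integrable_def by (auto dest: borel_measurable_integrable)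
  qed
  fix x :: "real ^ 'n"
  obtain N where "norm x \<le> real N" using real_arch_simple by blast
  then have "\<forall>i\<ge>N. indicator (cball 0 (real i)) x * \<mu> x = \<mu> x" by auto
  then show "(\<lambda>i. indicator (cball 0 (real i)) x * \<mu> x) \<longlonglongrightarrow> \<mu> x"
    by (intro tendsto_eventually eventually_sequentiallyI) blast
qed

lemma weight_nonneg: "is_weight \<mu> \<Longrightarrow> 0 \<le> \<mu> x"
  unfolding is_weight_def by blast

lemma sets_weight_measure [simp, measurable_cong]: "sets (weight_measure \<mu>) = sets lebesgue"
  and space_weight_measure [simp]: "space (weight_measure \<mu>) = UNIV"
  by (simp_all add: weight_measure_def)

lemma emeasure_weight_measure:
  assumes "is_weight \<mu>" "Q \<in> sets lebesgue"
  shows "emeasure (weight_measure \<mu>) Q = (\<integral>\<^sup>+x\<in>Q. ennreal (\<mu> x) \<partial>lebesgue)"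
  using assms borel_measurable_weight[OF assms(1)]
  unfolding weight_measure_def by (subst emeasure_density) auto

lemma emeasure_weight_measure_finite:
  assumes "is_weight \<mu>" "Q \<in> sets lebesgue" "bounded Q"
  shows "emeasure (weight_measure \<mu>) Q < \<infinity>"
proof -
  let ?K = "closure Q"
  have "set_integrable lebesgue ?K \<mu>" using assms unfolding is_weight_def by simp
  then have i: "integrable lebesgue (\<lambda>x. indicator ?K x * \<mu> x)" unfolding set_integrable_def by simp
  have "emeasure (weight_measure \<mu>) Q \<le> emeasure (weight_measure \<mu>) ?K"
    using assms(2) closure_subset by (intro emeasure_mono) auto
  also have "\<dots> = (\<integral>\<^sup>+x. ennreal (indicator ?K x * \<mu> x) \<partial>lebesgue)"
    by (subst emeasure_weight_measure[OF assms(1)])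
      (auto intro!: nn_integral_cong simp: indicator_def)
  also have "\<dots> < \<infinity>"
    using i weight_nonneg[OF assms(1)] by (subst nn_integral_eq_integral) auto
  finally show ?thesis .
qed

lemma emeasure_weight_measure_negligible:
  assumes "is_weight \<mu>" "negligible N"
  shows "emeasure (weight_measure \<mu>) N = 0"
proof -
  have N: "N \<in> null_sets lebesgue" using assms(2) by (simp add: negligible_iff_null_sets)
  then show ?thesis
    using emeasure_weight_measure[OF assms(1) null_setsD2[OF N]] by (simp add: nn_integral_null_set)
qed

lemma dyadic_gridE:
  assumes "Q \<in> dyadic_grid A"
  obtains k m where "Q = dyadic_cube A k m"
  using assms unfolding dyadic_grid_def by auto

lemma
  fixes A :: "'n::finite set"
  assumes "Q \<in> dyadic_grid A"
  shows sets_grid: "Q \<in> sets lebesgue" and lmeasurable_grid: "Q \<in> lmeasurable"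
    and measure_grid_pos: "0 < measure lebesgue Q"
    and closure_grid: "closure Q \<in> cubes" and negligible_closure_grid: "negligible (closure Q - Q)"
    and bounded_grid: "bounded Q"
proof -
  obtain k m where Q: "Q = dyadic_cube A k m" using assms by (rule dyadic_gridE)
  show "Q \<in> lmeasurable" "closure Q \<in> cubes" "negligible (closure Q - Q)" "0 < measure lebesgue Q"
    unfolding Q by (simp_all add: fmeasurable_dyadic_cube closure_dyadic_cube
        negligible_closure_dyadic_cube measure_dyadic_cube)
  then show "Q \<in> sets lebesgue" "bounded Q"
    using bounded_subset[OF _ closure_subset, of Q] by (auto simp: cubes_def)
qed

lemma emeasure_closure_grid:
  fixes A :: "'n::finite set"
  assumes "Q \<in> dyadic_grid A" "sets M = sets lebesgue" "\<And>N. negligible N \<Longrightarrow> emeasure M N = 0"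
  shows "emeasure M (closure Q) = emeasure M Q"
proof -
  have n: "negligible (closure Q - Q)" by (rule negligible_closure_grid[OF assms(1)])
  have "closure Q - Q \<in> null_sets M"
    using assms(3)[OF n] negligible_imp_sets[OF n] assms(2) by (intro null_setsI) simp_all
  moreover have "Q \<in> sets M" using sets_grid[OF assms(1)] assms(2) by simp
  ultimately have "emeasure M (Q \<union> (closure Q - Q)) = emeasure M Q"
    by (intro emeasure_Un_null_set)
  moreover have "Q \<union> (closure Q - Q) = closure Q" using closure_subset[of Q] by (simp add: Un_absorb1)
  ultimately show ?thesis by simp
qed

lemma emeasure_weight_closure_grid:
  fixes A :: "'n::finite set"
  assumes "is_weight \<mu>" "Q \<in> dyadic_grid A"
  shows "emeasure (weight_measure \<mu>) (closure Q) = emeasure (weight_measure \<mu>) Q"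
  using assms by (intro emeasure_closure_grid) (auto simp: emeasure_weight_measure_negligible)

lemma emeasure_lebesgue_closure_grid:
  fixes A :: "'n::finite set"
  assumes "Q \<in> dyadic_grid A"
  shows "emeasure lebesgue (closure Q) = emeasure lebesgue Q"
  using assms by (intro emeasure_closure_grid) (auto simp: negligible_iff_null_sets null_sets_def)

lemma emeasure_weight_grid:
  fixes A :: "'n::finite set"
  assumes "is_weight \<mu>" "Q \<in> dyadic_grid A"
  shows "emeasure (weight_measure \<mu>) Q = ennreal (measure (weight_measure \<mu>) Q)"
  using emeasure_weight_measure_finite[OF assms(1) sets_grid[OF assms(2)] bounded_grid[OF assms(2)]]
  by (simp add: emeasure_eq_ennreal_measure)

text \<open>The closure of \<open>P\<close> competes in the supremum and lies inside the closure of
  \<open>Q\<close>, where the cut-off leaves \<open>\<mu>\<close> unchanged.\<close>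

lemma average_le_maximal_function:
  fixes A :: "'n::finite set"
  assumes \<mu>: "is_weight \<mu>" and P: "P \<in> dyadic_grid A" "P \<subseteq> Q" and x: "x \<in> P"
  shows "ennreal (measure (weight_measure \<mu>) P / measure lebesgue P)
    \<le> maximal_function (\<lambda>y. \<mu> y * indicator (closure Q) y) x"
proof -
  let ?P = "closure P"
  have sub: "?P \<subseteq> closure Q" using P(2) by (rule closure_mono)
  have "(\<integral>\<^sup>+y\<in>?P. ennreal \<bar>\<mu> y * indicator (closure Q) y\<bar> \<partial>lebesgue) = (\<integral>\<^sup>+y\<in>?P. ennreal (\<mu> y) \<partial>lebesgue)"
    using sub weight_nonneg[OF \<mu>] by (intro nn_integral_cong) (auto simp: indicator_def)
  also have "\<dots> = ennreal (measure (weight_measure \<mu>) P)"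
    using emeasure_weight_measure[OF \<mu>, of ?P] emeasure_weight_closure_grid[OF \<mu> P(1)]
      emeasure_weight_grid[OF \<mu> P(1)] by simp
  finally have 1: "(\<integral>\<^sup>+y\<in>?P. ennreal \<bar>\<mu> y * indicator (closure Q) y\<bar> \<partial>lebesgue) = ennreal (measure (weight_measure \<mu>) P)" .
  have 2: "emeasure lebesgue ?P = ennreal (measure lebesgue P)"
    using emeasure_lebesgue_closure_grid[OF P(1)] lmeasurable_grid[OF P(1)]
    by (simp add: emeasure_eq_measure2)
  have "x \<in> ?P" using x closure_subset by blast
  then have "ennreal (measure (weight_measure \<mu>) P / measure lebesgue P) = indicator ?P x / emeasure lebesgue ?P *
      (\<integral>\<^sup>+y\<in>?P. ennreal \<bar>\<mu> y * indicator (closure Q) y\<bar> \<partial>lebesgue)"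
    unfolding 1 2 using measure_grid_pos[OF P(1)]
    by (simp add: divide_ennreal[symmetric] ennreal_times_divide[symmetric] mult.commute divide_ennreal_def)
  also have "\<dots> \<le> maximal_function (\<lambda>y. \<mu> y * indicator (closure Q) y) x"
    unfolding maximal_function_def using closure_grid[OF P(1)] by (rule SUP_upper)
  finally show ?thesis .
qed

section \<open>Packing controlled by \<open>rho\<close>\<close>

lemma rho_times_measure:
  fixes A :: "'n::finite set"
  assumes \<mu>: "is_weight \<mu>" and Q: "Q \<in> dyadic_grid A" and pos: "0 < measure (weight_measure \<mu>) Q"
  shows "rho \<mu> (closure Q) * ennreal (measure (weight_measure \<mu>) Q)
    = (\<integral>\<^sup>+x\<in>closure Q. maximal_function (\<lambda>y. \<mu> y * indicator (closure Q) y) x \<partial>lebesgue)"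
proof -
  have "emeasure (weight_measure \<mu>) (closure Q) = ennreal (measure (weight_measure \<mu>) Q)"
    using emeasure_weight_closure_grid[OF \<mu> Q] emeasure_weight_grid[OF \<mu> Q] by simp
  then show ?thesis
    unfolding rho_def using pos by (simp add: ennreal_divide_times mult_divide_eq_ennreal)
qed

text \<open>The function equal to the average of \<open>\<mu>\<close> over \<open>P\<close> on each
  \<open>E P\<close> is dominated pointwise by the maximal function, because the sets
  \<open>E P\<close> are disjoint and \<open>E P\<close> lies in \<open>P\<close>; integrating gives
  the numerator of \<open>rho\<close>. Nothing ties the sets \<open>E P\<close> to
  \<open>\<mu>\<close>, so the same ones can be used for two weights.\<close>

lemma rho_packing:
  fixes A :: "'n::finite set"
  assumes \<mu>: "is_weight \<mu>" and Q: "Q \<in> dyadic_grid A" and pos: "0 < measure (weight_measure \<mu>) Q"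
    and fin: "rho \<mu> (closure Q) < \<infinity>"
    and F: "finite F" "F \<subseteq> dyadic_grid A" "\<And>P. P \<in> F \<Longrightarrow> P \<subseteq> Q"
    and E: "\<And>P. P \<in> F \<Longrightarrow> E P \<subseteq> P" "\<And>P. P \<in> F \<Longrightarrow> E P \<in> sets lebesgue" "disjoint_family_on E F"
  shows "(\<Sum>P\<in>F. measure (weight_measure \<mu>) P / measure lebesgue P * measure lebesgue (E P))
    \<le> enn2real (rho \<mu> (closure Q)) * measure (weight_measure \<mu>) Q"
proof -
  let ?M = "maximal_function (\<lambda>y. \<mu> y * indicator (closure Q) y)"
  define c where "c P = measure (weight_measure \<mu>) P / measure lebesgue P" for P
  have c0: "0 \<le> c P" for P unfolding c_def by simp
  have pw: "(\<Sum>P\<in>F. ennreal (c P) * indicator (E P) x) \<le> ?M x * indicator (closure Q) x" for x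
  proof (cases "\<exists>P\<in>F. x \<in> E P")
    case True
    then obtain P where P: "P \<in> F" "x \<in> E P" by blast
    have "(\<Sum>P\<in>F. ennreal (c P) * indicator (E P) x) = (\<Sum>P\<in>{P}. ennreal (c P) * indicator (E P) x)"
    proof (rule sum.mono_neutral_right)
      show "\<forall>R\<in>F - {P}. ennreal (c R) * indicator (E R) x = 0"
        using disjoint_family_onD[OF E(3), of _ P] P by (auto simp: indicator_def)
    qed (use P F in auto)
    also have "\<dots> = ennreal (c P)" using P by simp
    also have "\<dots> \<le> ?M x"
      unfolding c_def using P F(2,3) E(1)[OF P(1)]
      by (intro average_le_maximal_function[OF \<mu>, of _ A]) auto
    also have "\<dots> = ?M x * indicator (closure Q) x"
    proof -
      have "x \<in> closure Q" using P E(1) F(3) closure_subset by blast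
      then show ?thesis by simp
    qed
    finally show ?thesis .
  next
    case False
    then have "(\<Sum>P\<in>F. ennreal (c P) * indicator (E P) x) = 0" by (intro sum.neutral) auto
    then show ?thesis by simp
  qed
  have EP: "emeasure lebesgue (E P) = ennreal (measure lebesgue (E P))" if "P \<in> F" for P
  proof -
    have "P \<in> lmeasurable" using that F(2) lmeasurable_grid by (metis subsetD)
    then have "E P \<in> lmeasurable" using E(1,2)[OF that] by (rule fmeasurableI2)
    then show ?thesis by (simp add: emeasure_eq_measure2)
  qed
  have "ennreal (\<Sum>P\<in>F. c P * measure lebesgue (E P)) = (\<Sum>P\<in>F. ennreal (c P) * emeasure lebesgue (E P))"
    using c0 EP by (subst sum_ennreal[symmetric]) (auto simp: ennreal_mult intro!: sum.cong)
  also have "\<dots> = (\<integral>\<^sup>+x. (\<Sum>P\<in>F. ennreal (c P) * indicator (E P) x) \<partial>lebesgue)"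
    using E(2) by (subst nn_integral_sum) (auto simp: nn_integral_cmult_indicator)
  also have "\<dots> \<le> (\<integral>\<^sup>+x\<in>closure Q. ?M x \<partial>lebesgue)"
    by (intro nn_integral_mono pw)
  also have "\<dots> = rho \<mu> (closure Q) * ennreal (measure (weight_measure \<mu>) Q)"
    using rho_times_measure[OF \<mu> Q pos] by simp
  also have "\<dots> = ennreal (enn2real (rho \<mu> (closure Q)) * measure (weight_measure \<mu>) Q)"
    using fin by (simp add: ennreal_mult)
  finally show ?thesis unfolding c_def by (subst (asm) ennreal_le_iff) auto
qed

text \<open>This is \<open>rho_packing\<close> for the family \<open>{Q}\<close> with all of
  \<open>Q\<close> as the disjoint part. It guarantees that the entropy functions are evaluated
  inside \<open>[1, \<infinity>)\<close>.\<close>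

lemma rho_ge_1:
  fixes A :: "'n::finite set"
  assumes \<mu>: "is_weight \<mu>" and Q: "Q \<in> dyadic_grid A" and pos: "0 < measure (weight_measure \<mu>) Q"
    and fin: "rho \<mu> (closure Q) < \<infinity>"
  shows "1 \<le> enn2real (rho \<mu> (closure Q))"
proof -
  have "(\<Sum>P\<in>{Q}. measure (weight_measure \<mu>) P / measure lebesgue P * measure lebesgue P)
    \<le> enn2real (rho \<mu> (closure Q)) * measure (weight_measure \<mu>) Q"
    using Q sets_grid[OF Q] by (intro rho_packing[OF assms]) (auto simp: disjoint_family_on_def)
  then show ?thesis using pos measure_grid_pos[OF Q] by simp
qed

text \<open>Product of the packing constant of \<open>entropy_packing\<close> and the factor
  \<open>(2 * c) powr s\<close> of \<open>Carleson_embedding\<close>; the entropy function enters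
  only through \<open>\<epsilon> 1\<close>.\<close>

definition Carleson_const :: "real \<Rightarrow> (real \<Rightarrow> real) \<Rightarrow> real" where
  "Carleson_const s \<epsilon> = 4 * (\<epsilon> 1 powr - s + 2) * (2 * (1 / (1 - 2 powr (1 - s)))) powr s"

text \<open>Sparseness bounds the mass of \<open>P\<close> by twice its average times the measure of
  \<open>E P\<close>, so \<open>rho_packing\<close> supplies the packing hypothesis of
  \<open>entropy_packing\<close>, whose conclusion is in turn the Carleson condition for the
  coefficients used here. It is applied with \<open>s = p\<close> for \<open>\<sigma>\<close> and
  \<open>s = conj_exp q\<close> for \<open>w\<close>.\<close>

lemma entropy_Carleson_embedding:
  fixes A :: "'n::finite set" and f :: "real ^ 'n \<Rightarrow> real"
  defines "r \<equiv> \<lambda>\<mu> Q. enn2real (rho \<mu> (closure Q))"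
  assumes \<mu>: "is_weight \<mu>" and ent: "entropy_function s \<epsilon>" "1 < s"
    and F: "finite F" "F \<subseteq> dyadic_grid A" and pos: "\<And>Q. Q \<in> F \<Longrightarrow> 0 < measure (weight_measure \<mu>) Q"
    and fin: "\<And>Q. Q \<in> F \<Longrightarrow> rho \<mu> (closure Q) < \<infinity>"
    and E: "\<And>P. P \<in> F \<Longrightarrow> E P \<subseteq> P" "\<And>P. P \<in> F \<Longrightarrow> E P \<in> sets lebesgue" "disjoint_family_on E F"
      "\<And>P. P \<in> F \<Longrightarrow> measure lebesgue P \<le> 2 * measure lebesgue (E P)"
    and f: "\<And>x. 0 \<le> f x" "\<And>Q. Q \<in> F \<Longrightarrow> set_integrable (weight_measure \<mu>) Q f"
      "integrable (weight_measure \<mu>) (\<lambda>x. f x powr s)"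
  shows "(\<Sum>Q\<in>F. measure (weight_measure \<mu>) Q / (r \<mu> Q * \<epsilon> (r \<mu> Q) powr s)
      * ((LINT x:Q|weight_measure \<mu>. f x) / measure (weight_measure \<mu>) Q) powr s)
    \<le> Carleson_const s \<epsilon> * (LINT x|weight_measure \<mu>. f x powr s)"
proof -
  let ?m = "measure (weight_measure \<mu>)"
  have lam: "laminar F" using laminar_subset[OF laminar_dyadic_grid F(2)] .
  have r1: "1 \<le> r \<mu> Q" if "Q \<in> F" for Q
    unfolding r_def using that F(2) by (intro rho_ge_1[OF \<mu>] pos fin) auto
  have e1: "0 < \<epsilon> t" if "1 \<le> t" for t using ent(1) that unfolding entropy_function_def by blast
  have finm: "emeasure (weight_measure \<mu>) Q < \<infinity>" if "Q \<in> F" for Q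
  proof -
    have "Q \<in> dyadic_grid A" using that F(2) by auto
    then show ?thesis by (intro emeasure_weight_measure_finite[OF \<mu>] sets_grid bounded_grid)
  qed
  have sm: "F \<subseteq> sets lebesgue" using F(2) sets_grid by blast
  have pack: "(\<Sum>P\<in>{P\<in>F. P \<subseteq> Q}. ?m P) \<le> 2 * r \<mu> Q * ?m Q" if Q: "Q \<in> F" for Q
  proof -
    have "(\<Sum>P\<in>{P\<in>F. P \<subseteq> Q}. ?m P) \<le> (\<Sum>P\<in>{P\<in>F. P \<subseteq> Q}. 2 * (?m P / measure lebesgue P * measure lebesgue (E P)))"
    proof (rule sum_mono)
      fix P assume "P \<in> {P\<in>F. P \<subseteq> Q}"
      then have P: "P \<in> F" "0 < measure lebesgue P" using F(2) measure_grid_pos by auto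
      have "?m P / measure lebesgue P * measure lebesgue P \<le> ?m P / measure lebesgue P * (2 * measure lebesgue (E P))"
        using E(4)[OF P(1)] by (intro mult_left_mono) auto
      then show "?m P \<le> 2 * (?m P / measure lebesgue P * measure lebesgue (E P))"
        using P(2) by (simp add: mult_ac)
    qed
    also have "\<dots> = 2 * (\<Sum>P\<in>{P\<in>F. P \<subseteq> Q}. ?m P / measure lebesgue P * measure lebesgue (E P))"
      by (simp only: sum_distrib_left)
    also have "\<dots> \<le> 2 * (r \<mu> Q * ?m Q)"
    proof -
      have Fs: "{P\<in>F. P \<subseteq> Q} \<subseteq> F" by blast
      have "Q \<in> dyadic_grid A" using Q F(2) by blast
      moreover have "finite {P\<in>F. P \<subseteq> Q}" "{P\<in>F. P \<subseteq> Q} \<subseteq> dyadic_grid A" using F by auto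
      moreover have "disjoint_family_on E {P\<in>F. P \<subseteq> Q}" using disjoint_family_on_mono[OF Fs E(3)] .
      ultimately have "(\<Sum>P\<in>{P\<in>F. P \<subseteq> Q}. ?m P / measure lebesgue P * measure lebesgue (E P))
          \<le> enn2real (rho \<mu> (closure Q)) * ?m Q"
        using pos[OF Q] fin[OF Q] E(1,2) by (intro rho_packing[OF \<mu>]) simp_all
      then show ?thesis by (simp add: r_def)
    qed
    finally show ?thesis by simp
  qed
  have "(\<Sum>Q\<in>F. ?m Q / (r \<mu> Q * \<epsilon> (r \<mu> Q) powr s) * ((LINT x:Q|weight_measure \<mu>. f x) / ?m Q) powr s)
    \<le> (4 * (\<epsilon> 1 powr - s + 2)) * (2 * (1 / (1 - 2 powr (1 - s)))) powr s * (LINT x|weight_measure \<mu>. f x powr s)"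
  proof (rule Carleson_embedding[OF ent(2) F(1) lam])
    fix R assume R: "R \<in> F"
    show "(\<Sum>Q\<in>{Q\<in>F. Q \<subseteq> R}. ?m Q / (r \<mu> Q * \<epsilon> (r \<mu> Q) powr s)) \<le> 4 * (\<epsilon> 1 powr - s + 2) * ?m R"
    proof (rule entropy_packing[OF ent(1) _ F(1) lam r1 _ pack _ R])
      fix G Q assume "G \<subseteq> F" "disjoint G" "Q \<in> F" "\<And>P. P \<in> G \<Longrightarrow> P \<subseteq> Q"
      then show "sum ?m G \<le> ?m Q"
        using sm F(1) finm by (intro sum_measure_disjoint) (auto intro: finite_subset)
    qed (use ent(2) in auto)
    show "0 \<le> ?m R / (r \<mu> R * \<epsilon> (r \<mu> R) powr s)"
      using r1[OF R] by simp
  qed (use f pos finm sm in auto)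
  then show ?thesis unfolding Carleson_const_def .
qed

section \<open>The bilinear bound\<close>

lemma conj_exp_gt_1: "1 < p \<Longrightarrow> 1 < conj_exp p"
  by (simp add: conj_exp_def)

lemma inverse_conj_exp: "1 < p \<Longrightarrow> 1 / conj_exp p = 1 - 1 / p"
  by (simp add: conj_exp_def field_simps)

lemma conj_exp_antimono: "1 < p \<Longrightarrow> p \<le> q \<Longrightarrow> conj_exp q \<le> conj_exp p"
  by (simp add: conj_exp_def field_simps)

text \<open>Since \<open>p \<le> q\<close>, the exponents satisfy \<open>1 / p + 1 / q' \<ge> 1\<close>, which is enough for sums.\<close>

lemma Holder_sum:
  fixes u v :: "'a \<Rightarrow> real"
  assumes "finite S" "1 < p" "p \<le> q" and u: "\<And>x. x \<in> S \<Longrightarrow> 0 \<le> u x" and v: "\<And>x. x \<in> S \<Longrightarrow> 0 \<le> v x"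
  shows "(\<Sum>x\<in>S. u x * v x)
    \<le> (\<Sum>x\<in>S. u x powr p) powr (1 / p) * (\<Sum>x\<in>S. v x powr conj_exp q) powr (1 / conj_exp q)"
proof -
  define q' where "q' = conj_exp q"
  have q': "1 < q'" "q' \<le> conj_exp p" unfolding q'_def using assms conj_exp_gt_1 conj_exp_antimono by auto
  define U where "U = (\<Sum>x\<in>S. u x powr p)"
  define V where "V = (\<Sum>x\<in>S. v x powr q')"
  have leU: "u x powr p \<le> U" if "x \<in> S" for x
    unfolding U_def using assms(1) that by (intro member_le_sum) auto
  have leV: "v x powr q' \<le> V" if "x \<in> S" for x
    unfolding V_def using assms(1) that by (intro member_le_sum) auto
  have UV0: "0 \<le> U" "0 \<le> V" unfolding U_def V_def by (auto intro: sum_nonneg)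
  show ?thesis
  proof (cases "U = 0 \<or> V = 0")
    case True
    have "u x * v x = 0" if x: "x \<in> S" for x
    proof -
      have "u x powr p \<le> 0 \<or> v x powr q' \<le> 0" using True leU[OF x] leV[OF x] by auto
      then show ?thesis by auto
    qed
    then have "(\<Sum>x\<in>S. u x * v x) = 0" by (intro sum.neutral) blast
    then show ?thesis by simp
  next
    case False
    then have UV: "0 < U" "0 < V" using UV0 by auto
    define a where "a = U powr (1 / p)"
    define b where "b = V powr (1 / q')"
    have ab: "0 < a" "0 < b" unfolding a_def b_def using UV by auto
    have ap: "a powr p = U" and bq: "b powr q' = V"
      unfolding a_def b_def using UV assms q' by (auto simp: powr_powr)
    have "(\<Sum>x\<in>S. (u x / a) * (v x / b)) \<le> (\<Sum>x\<in>S. u x powr p / U / p + v x powr q' / V / conj_exp p)"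
    proof (rule sum_mono)
      fix x assume x: "x \<in> S"
      have "(u x / a) * (v x / b) \<le> (u x / a) powr p / p + (v x / b) powr conj_exp p / conj_exp p"
        using assms conj_exp_gt_1[of p] inverse_conj_exp[of p] u[OF x] v[OF x] ab
        by (intro Youngs_inequality) auto
      \<comment> \<open>Normalisation makes \<open>v x / b \<le> 1\<close>, so passing from
        \<open>conj_exp p\<close> to the smaller exponent \<open>q'\<close> increases the power;
        this is where \<open>p \<le> q\<close> enters.\<close>
      also have "(v x / b) powr conj_exp p \<le> (v x / b) powr q'"
      proof (rule powr_mono')
        have "(v x / b) powr q' \<le> 1"
          using leV[OF x] UV v[OF x] ab by (simp add: powr_divide bq)
        then show "v x / b \<le> 1"
          using powr_less_mono2[of q' 1 "v x / b"] q' by fastforce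
      qed (use v[OF x] ab q' in auto)
      also have "(u x / a) powr p = u x powr p / U"
        using u[OF x] ab by (simp add: powr_divide ap)
      also have "(v x / b) powr q' = v x powr q' / V"
        using v[OF x] ab by (simp add: powr_divide bq)
      finally show "(u x / a) * (v x / b) \<le> u x powr p / U / p + v x powr q' / V / conj_exp p"
        using conj_exp_gt_1[OF assms(2)] by (simp add: divide_right_mono)
    qed
    also have "\<dots> = U / U / p + V / V / conj_exp p"
      by (simp only: sum.distrib sum_divide_distrib U_def V_def)
    also have "\<dots> = 1" using UV assms(2) inverse_conj_exp[of p] by simp
    finally have "(\<Sum>x\<in>S. u x * v x) / (a * b) \<le> 1"
      by (simp add: sum_divide_distrib)
    then show ?thesis using ab by (simp add: a_def b_def U_def V_def q'_def)
  qed
qed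

lemma
  fixes f :: "real ^ 'n \<Rightarrow> real"
  assumes "is_weight \<mu>" "f \<in> borel_measurable lebesgue" "Q \<in> sets lebesgue"
  shows set_integral_weight_measure: "(LINT x:Q|weight_measure \<mu>. f x) = (LINT x:Q|lebesgue. \<mu> x * f x)"
    and set_integrable_weight_measure: "set_integrable (weight_measure \<mu>) Q f \<longleftrightarrow> set_integrable lebesgue Q (\<lambda>x. \<mu> x * f x)"
proof -
  have m: "(\<lambda>x. indicator Q x * f x) \<in> borel_measurable lebesgue" "\<mu> \<in> borel_measurable lebesgue"
    using assms borel_measurable_weight by auto
  show "(LINT x:Q|weight_measure \<mu>. f x) = (LINT x:Q|lebesgue. \<mu> x * f x)"
    unfolding set_lebesgue_integral_def weight_measure_def
    using m weight_nonneg[OF assms(1)] by (subst integral_density) (auto simp: mult_ac)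
  show "set_integrable (weight_measure \<mu>) Q f \<longleftrightarrow> set_integrable lebesgue Q (\<lambda>x. \<mu> x * f x)"
    unfolding set_integrable_def weight_measure_def
    using m weight_nonneg[OF assms(1)] by (subst integrable_density) (auto simp: mult_ac)
qed

lemma set_integrable_of_integrable_powr:
  fixes f :: "'a \<Rightarrow> real"
  assumes "1 \<le> p" "integrable M (\<lambda>x. f x powr p)" "f \<in> borel_measurable M" "\<And>x. 0 \<le> f x"
    "Q \<in> sets M" "emeasure M Q < \<infinity>"
  shows "set_integrable M Q f"
  unfolding set_integrable_def
proof (rule Bochner_Integration.integrable_bound)
  show "integrable M (\<lambda>x. indicator Q x + f x powr p)"
    using assms by (intro Bochner_Integration.integrable_add integrable_real_indicator)
  show "(\<lambda>x. indicator Q x *\<^sub>R f x) \<in> borel_measurable M" using assms by measurable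
  have "f x \<le> 1 + f x powr p" for x
  proof (cases "f x \<le> 1")
    case False
    then have "f x powr 1 \<le> f x powr p" using assms(1) by (intro powr_mono) auto
    then show ?thesis using False by simp
  qed (simp add: add_increasing2)
  then show "AE x in M. norm (indicator Q x *\<^sub>R f x) \<le> norm (indicator Q x + f x powr p)"
    using assms(4) by (intro AE_I2) (auto simp: indicator_def)
qed

text \<open>The bracket bounds \<open>beta\<close> at the closure of \<open>Q\<close>, where all
  masses agree with those of \<open>Q\<close>. Positive masses exclude the branch with value
  \<open>0\<close>, finiteness of the bracket excludes the branch with value
  \<open>\<infinity>\<close>, and the explicit product remains.\<close>

lemma beta_le:
  fixes A :: "'n::finite set"
  defines "r \<equiv> \<lambda>\<mu> Q. enn2real (rho \<mu> (closure Q))"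
  assumes "is_weight \<sigma>" "is_weight w" "Q \<in> dyadic_grid A" "entropy_bracket \<alpha> p q \<epsilon> \<epsilon>' \<sigma> w < \<infinity>"
    and pos: "0 < measure (weight_measure \<sigma>) Q" "0 < measure (weight_measure w) Q"
  shows "rho \<sigma> (closure Q) < \<infinity>" "rho w (closure Q) < \<infinity>"
    "measure (weight_measure \<sigma>) Q powr (1 / conj_exp p) * measure (weight_measure w) Q powr (1 / q)
      / measure lebesgue Q powr (1 - \<alpha> / real CARD('n))
      * r \<sigma> Q powr (1 / p) * \<epsilon> (r \<sigma> Q) * r w Q powr (1 / conj_exp q) * \<epsilon>' (r w Q)
    \<le> enn2real (entropy_bracket \<alpha> p q \<epsilon> \<epsilon>' \<sigma> w)" (is "?X \<le> _")
proof -
  have le: "beta \<alpha> p q \<epsilon> \<epsilon>' \<sigma> w (closure Q) \<le> entropy_bracket \<alpha> p q \<epsilon> \<epsilon>' \<sigma> w"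
    unfolding entropy_bracket_def using closure_grid[OF assms(4)] by (rule SUP_upper)
  then have fin: "beta \<alpha> p q \<epsilon> \<epsilon>' \<sigma> w (closure Q) < \<infinity>" using assms(5) by (rule le_less_trans)
  have em: "emeasure (weight_measure \<mu>) (closure Q) = ennreal (measure (weight_measure \<mu>) Q)" if "is_weight \<mu>" for \<mu>
    using emeasure_weight_closure_grid[OF that assms(4)] emeasure_weight_grid[OF that assms(4)] by simp
  have ml: "measure lebesgue (closure Q) = measure lebesgue Q"
    using emeasure_lebesgue_closure_grid[OF assms(4)] by (simp add: measure_def)
  have mw: "measure (weight_measure \<mu>) (closure Q) = measure (weight_measure \<mu>) Q" if "is_weight \<mu>" for \<mu>
    using em[OF that] by (simp add: measure_def)
  show f: "rho \<sigma> (closure Q) < \<infinity>" "rho w (closure Q) < \<infinity>"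
    using fin pos unfolding beta_def em[OF assms(2)] em[OF assms(3)]
    by (auto simp: less_top split: if_splits)
  have "beta \<alpha> p q \<epsilon> \<epsilon>' \<sigma> w (closure Q) = ennreal ?X"
    using pos f unfolding beta_def em[OF assms(2)] em[OF assms(3)] r_def Let_def ml mw[OF assms(2)] mw[OF assms(3)]
    by (simp add: less_top[symmetric])
  then have "ennreal ?X \<le> entropy_bracket \<alpha> p q \<epsilon> \<epsilon>' \<sigma> w" using le by simp
  also have "\<dots> = ennreal (enn2real (entropy_bracket \<alpha> p q \<epsilon> \<epsilon>' \<sigma> w))" using assms(5) by simp
  finally show "?X \<le> enn2real (entropy_bracket \<alpha> p q \<epsilon> \<epsilon>' \<sigma> w)" by (subst (asm) ennreal_le_iff) auto
qed


text \<open>Below a principal cube \<open>R\<close> the average of \<open>f \<sigma>\<close> is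
  frozen at \<open>2 * l R\<close>. What remains is a sum of integrals of \<open>g w\<close> with
  volume factors that decay geometrically over the generations, so it is comparable to its term at
  \<open>R\<close>. The bracket is therefore evaluated at principal cubes alone.\<close>

lemma dyadic_bilinear_bound:
  fixes A :: "'n::finite set" and f g :: "real ^ 'n \<Rightarrow> real"
  defines "d \<equiv> real CARD('n)"
  assumes \<alpha>: "0 < \<alpha>" and pq: "1 < p" "p \<le> q"
    and ent: "entropy_function p \<epsilon>" "entropy_function (conj_exp q) \<epsilon>'"
    and \<sigma>: "is_weight \<sigma>" and w: "is_weight w"
    and B: "entropy_bracket \<alpha> p q \<epsilon> \<epsilon>' \<sigma> w < \<infinity>"
    and F: "finite F" "F \<subseteq> dyadic_grid A"
    and f: "\<And>x. 0 \<le> f x" "f \<in> borel_measurable lebesgue" "integrable (weight_measure \<sigma>) (\<lambda>x. f x powr p)"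
    and g: "\<And>x. 0 \<le> g x" "g \<in> borel_measurable lebesgue" "integrable (weight_measure w) (\<lambda>x. g x powr conj_exp q)"
  shows "(\<Sum>Q\<in>F. measure lebesgue Q powr (\<alpha> / d - 1) * (LINT x:Q|weight_measure \<sigma>. f x) * (LINT x:Q|weight_measure w. g x))
    \<le> 2 / (1 - 2 powr - \<alpha>) * Carleson_const p \<epsilon> powr (1 / p) * Carleson_const (conj_exp q) \<epsilon>' powr (1 / conj_exp q)
      * enn2real (entropy_bracket \<alpha> p q \<epsilon> \<epsilon>' \<sigma> w)
      * (LINT x|weight_measure \<sigma>. f x powr p) powr (1 / p)
      * (LINT x|weight_measure w. g x powr conj_exp q) powr (1 / conj_exp q)"
proof -
  define q' where "q' = conj_exp q"
  have q1: "1 < q" using pq by simp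
  have q': "1 < q'" unfolding q'_def using conj_exp_gt_1[OF q1] .
  define fi where "fi Q = (LINT x:Q|weight_measure \<sigma>. f x)" for Q
  define gi where "gi Q = (LINT x:Q|weight_measure w. g x)" for Q
  define ms where "ms = measure (weight_measure \<sigma>)"
  define mw where "mw = measure (weight_measure w)"
  define ml where "ml = measure (lebesgue :: (real ^ 'n) measure)"
  define rs where "rs Q = enn2real (rho \<sigma> (closure Q))" for Q
  define rw where "rw Q = enn2real (rho w (closure Q))" for Q
  define b where "b = enn2real (entropy_bracket \<alpha> p q \<epsilon> \<epsilon>' \<sigma> w)"
  define c where "c = 1 / (1 - 2 powr - \<alpha>)"
  have c0: "0 < c" unfolding c_def using \<alpha> by (simp add: powr_less_one)
  have b0: "0 \<le> b" unfolding b_def by simp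
  have fi0: "0 \<le> fi Q" and gi0: "0 \<le> gi Q" for Q
    unfolding fi_def gi_def set_lebesgue_integral_def using f(1) g(1) by (auto intro: integral_nonneg_AE)
  have grid: "Q \<in> sets lebesgue" "emeasure (weight_measure \<sigma>) Q < \<infinity>" "emeasure (weight_measure w) Q < \<infinity>"
    "0 < ml Q" "emeasure lebesgue Q < \<infinity>" if "Q \<in> dyadic_grid A" for Q
    using that sets_grid[OF that] bounded_grid[OF that] measure_grid_pos[OF that] lmeasurable_grid[OF that]
    by (auto simp: ml_def fmeasurable_def emeasure_weight_measure_finite[OF \<sigma>, simplified] emeasure_weight_measure_finite[OF w, simplified])
  have fint: "set_integrable (weight_measure \<sigma>) Q f" and gint: "set_integrable (weight_measure w) Q g"
    if "Q \<in> dyadic_grid A" for Q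
  proof -
    have fm: "f \<in> borel_measurable (weight_measure \<sigma>)" "g \<in> borel_measurable (weight_measure w)"
      using f(2) g(2) by (simp_all cong: measurable_cong_sets)
    have Q: "Q \<in> sets (weight_measure \<sigma>)" "Q \<in> sets (weight_measure w)" using grid(1)[OF that] by simp_all
    show "set_integrable (weight_measure \<sigma>) Q f"
      using pq by (intro set_integrable_of_integrable_powr[OF _ f(3) fm(1) f(1) Q(1) grid(2)[OF that]]) simp
    show "set_integrable (weight_measure w) Q g"
      using q' by (intro set_integrable_of_integrable_powr[OF _ g(3) fm(2) g(1) Q(2) grid(3)[OF that]]) (simp add: q'_def)
  qed
  define l where "l Q = fi Q / ml Q" for Q
  have l0: "0 \<le> l Q" for Q unfolding l_def ml_def using fi0 by simp
  have leb: "fi Q = (LINT x:Q|lebesgue. \<sigma> x * f x)" if "Q \<in> dyadic_grid A" for Q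
    unfolding fi_def using set_integral_weight_measure[OF \<sigma> f(2) grid(1)[OF that]] .
  obtain S where S: "S \<subseteq> F" "\<And>Q. Q \<in> F \<Longrightarrow> \<exists>R\<in>S. Q \<subseteq> R \<and> l Q \<le> 2 * l R"
    "\<And>R R'. R \<in> S \<Longrightarrow> R' \<in> S \<Longrightarrow> R' \<subset> R \<Longrightarrow> 2 * l R < l R'"
    using principal_subfamily[OF F(1), of l] l0 by metis
  have Sg: "S \<subseteq> dyadic_grid A" using S(1) F(2) by simp
  have finS: "finite S" using finite_subset[OF S(1) F(1)] .
  have lam: "laminar S" using laminar_subset[OF laminar_dyadic_grid Sg] .
  \<comment> \<open>The part of \<open>R\<close> outside all smaller principal cubes. These parts
    are disjoint by laminarity, and the doubling of averages makes each at least half of its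
    cube.\<close>
  define E where "E R = R - \<Union>{R'\<in>S. R' \<subset> R}" for R
  have E1: "E R \<subseteq> R" for R unfolding E_def by blast
  have E2: "E R \<in> sets lebesgue" if "R \<in> S" for R
  proof -
    have "finite {R'\<in>S. R' \<subset> R}" using finS by simp
    moreover have "{R'\<in>S. R' \<subset> R} \<subseteq> sets lebesgue" using Sg grid(1) by auto
    ultimately show ?thesis
      unfolding E_def using grid(1) that Sg by (intro sets.Diff sets.finite_Union) auto
  qed
  have E3: "disjoint_family_on E S"
    unfolding disjoint_family_on_def
  proof (intro ballI impI)
    fix R R' assume R: "R \<in> S" "R' \<in> S" "R \<noteq> R'"
    then have "R \<subset> R' \<or> R' \<subset> R \<or> R \<inter> R' = {}" using laminarD[OF lam, of R R'] by auto
    then show "E R \<inter> E R' = {}" unfolding E_def using R by auto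
  qed
  have E4: "measure lebesgue R \<le> 2 * measure lebesgue (E R)" if R: "R \<in> S" for R
    unfolding E_def
  proof (rule sparse_of_doubling[OF finS lam, where h = "\<lambda>x. \<sigma> x * f x"])
    show "S \<subseteq> sets lebesgue" using Sg grid(1) by auto
    fix Q assume Q: "Q \<in> S"
    then have Qg: "Q \<in> dyadic_grid A" using Sg by auto
    show "emeasure lebesgue Q < \<infinity>" "0 < measure lebesgue Q" using grid[OF Qg] unfolding ml_def by auto
    show "set_integrable lebesgue Q (\<lambda>x. \<sigma> x * f x)"
      using fint[OF Qg] set_integrable_weight_measure[OF \<sigma> f(2) grid(1)[OF Qg]] by simp
  next
    fix P Q assume PQ: "P \<in> S" "Q \<in> S" "Q \<subset> P"
    then have "P \<in> dyadic_grid A" "Q \<in> dyadic_grid A" using Sg by auto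
    then show "2 * ((LINT x:P|lebesgue. \<sigma> x * f x) / measure lebesgue P) < (LINT x:Q|lebesgue. \<sigma> x * f x) / measure lebesgue Q"
      using S(3)[OF PQ] unfolding l_def ml_def by (simp add: leb)
  qed (use f(1) weight_nonneg[OF \<sigma>] R in auto)
  have "(\<Sum>Q\<in>F. ml Q powr (\<alpha> / d - 1) * fi Q * gi Q) = (\<Sum>Q\<in>F. l Q * (ml Q powr (\<alpha> / d) * gi Q))"
  proof (rule sum.cong[OF refl])
    fix Q assume "Q \<in> F"
    then have "0 < ml Q" using F(2) grid(4) by auto
    then show "ml Q powr (\<alpha> / d - 1) * fi Q * gi Q = l Q * (ml Q powr (\<alpha> / d) * gi Q)"
      by (simp add: l_def powr_diff)
  qed
  also have "\<dots> \<le> (\<Sum>Q\<in>F. \<Sum>R\<in>S. if Q \<subseteq> R then 2 * l R * (ml Q powr (\<alpha> / d) * gi Q) else 0)"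
  proof (rule sum_mono)
    fix Q assume Q: "Q \<in> F"
    then obtain R where R: "R \<in> S" "Q \<subseteq> R" "l Q \<le> 2 * l R" using S(2) by metis
    have "l Q * (ml Q powr (\<alpha> / d) * gi Q) \<le> (\<Sum>R\<in>{R}. if Q \<subseteq> R then 2 * l R * (ml Q powr (\<alpha> / d) * gi Q) else 0)"
      using R gi0[of Q] by (auto intro!: mult_right_mono)
    also have "\<dots> \<le> (\<Sum>R\<in>S. if Q \<subseteq> R then 2 * l R * (ml Q powr (\<alpha> / d) * gi Q) else 0)"
      using R(1) finS l0 gi0 by (intro sum_mono2) auto
    finally show "l Q * (ml Q powr (\<alpha> / d) * gi Q) \<le> \<dots>" .
  qed
  also have "\<dots> = (\<Sum>R\<in>S. \<Sum>Q\<in>F. if Q \<subseteq> R then 2 * l R * (ml Q powr (\<alpha> / d) * gi Q) else 0)"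
    by (rule sum.swap)
  also have "\<dots> = (\<Sum>R\<in>S. 2 * l R * (\<Sum>Q\<in>{Q\<in>F. Q \<subseteq> R}. ml Q powr (\<alpha> / d) * gi Q))"
    by (simp add: sum.inter_filter[symmetric] F(1) sum_distrib_left)
  also have "\<dots> \<le> (\<Sum>R\<in>S. 2 * l R * (c * (ml R powr (\<alpha> / d) * gi R)))"
  proof (rule sum_mono)
    fix R assume "R \<in> S"
    then have R: "R \<in> dyadic_grid A" using Sg by auto
    have "(\<Sum>Q\<in>{Q\<in>F. Q \<subseteq> R}. ml Q powr (\<alpha> / d) * gi Q) \<le> c * (ml R powr (\<alpha> / d) * gi R)"
      unfolding c_def ml_def d_def
    proof (rule dyadic_generations_sum[OF \<alpha> F R gi0])
      fix G assume "finite G" "G \<subseteq> dyadic_grid A" "disjoint G" "\<And>Q. Q \<in> G \<Longrightarrow> Q \<subseteq> R"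
      then show "sum gi G \<le> gi R"
        unfolding gi_def using grid(1) gint[OF R] g(1)
        by (intro sum_set_integral_disjoint) auto
    qed
    then show "2 * l R * (\<Sum>Q\<in>{Q\<in>F. Q \<subseteq> R}. ml Q powr (\<alpha> / d) * gi Q) \<le> 2 * l R * (c * (ml R powr (\<alpha> / d) * gi R))"
      using l0[of R] by (intro mult_left_mono) auto
  qed
  also have "\<dots> = 2 * c * (\<Sum>R\<in>S. l R * (ml R powr (\<alpha> / d) * gi R))"
    by (simp add: sum_distrib_left mult_ac)
  finally have main1: "(\<Sum>Q\<in>F. ml Q powr (\<alpha> / d - 1) * fi Q * gi Q)
      \<le> 2 * c * (\<Sum>R\<in>S. l R * (ml R powr (\<alpha> / d) * gi R))" .
  \<comment> \<open>Where one of the weights has mass zero, \<open>beta\<close> is \<open>0\<close>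
    by convention and carries no information; but there \<open>f \<sigma>\<close> or
    \<open>g w\<close> integrates to zero, so these terms vanish.\<close>
  define T where "T = {R\<in>S. 0 < ms R \<and> 0 < mw R}"
  have TS: "T \<subseteq> S" unfolding T_def by blast
  then have Tg: "T \<subseteq> dyadic_grid A" using Sg by blast
  have finT: "finite T" using finite_subset[OF TS finS] .
  have "(\<Sum>R\<in>S. l R * (ml R powr (\<alpha> / d) * gi R)) = (\<Sum>R\<in>T. l R * (ml R powr (\<alpha> / d) * gi R))"
  proof (rule sum.mono_neutral_right[OF finS TS], intro ballI)
    fix R assume R: "R \<in> S - T"
    then have Rg: "R \<in> dyadic_grid A" using Sg by auto
    have z: "(LINT x:R|M. h x) = 0" if "measure M R = 0" "R \<in> sets M" "emeasure M R < \<infinity>" for M and h :: "_ \<Rightarrow> real"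
    proof -
      have "R \<in> null_sets M" using that by (auto simp: null_sets_def emeasure_eq_ennreal_measure)
      then have "AE x in M. indicator R x *\<^sub>R h x = 0" using AE_not_in by fastforce
      then show ?thesis unfolding set_lebesgue_integral_def by (rule integral_eq_zero_AE)
    qed
    have "ms R = 0 \<or> mw R = 0"
      using R unfolding T_def ms_def mw_def by (auto simp: zero_less_measure_iff)
    then have "fi R = 0 \<or> gi R = 0"
      unfolding fi_def gi_def ms_def mw_def using z grid[OF Rg] by auto
    then show "l R * (ml R powr (\<alpha> / d) * gi R) = 0" unfolding l_def by auto
  qed
  also have "\<dots> \<le> (\<Sum>R\<in>T. b * ((ms R / (rs R * \<epsilon> (rs R) powr p)) powr (1 / p) * (fi R / ms R)
      * ((mw R / (rw R * \<epsilon>' (rw R) powr q')) powr (1 / q') * (gi R / mw R))))"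
  proof (rule sum_mono)
    fix R assume "R \<in> T"
    then have R: "R \<in> dyadic_grid A" "0 < ms R" "0 < mw R" using Tg unfolding T_def by auto
    note bl = beta_le[OF \<sigma> w R(1) B R(2,3)[unfolded ms_def mw_def], folded ms_def mw_def rs_def rw_def ml_def b_def q'_def]
    have rs1: "1 \<le> rs R" and rw1: "1 \<le> rw R"
      unfolding rs_def rw_def using R bl(1,2) unfolding ms_def mw_def by (auto intro!: rho_ge_1[OF \<sigma>] rho_ge_1[OF w])
    have e: "0 < \<epsilon> (rs R)" "0 < \<epsilon>' (rw R)" using ent rs1 rw1 unfolding entropy_function_def by auto
    have m: "0 < ml R" using grid(4)[OF R(1)] .
    \<comment> \<open>\<open>X\<close> is \<open>beta\<close> at the closure of \<open>R\<close>,
      and \<open>Y\<close> is what is left for Hoelder's inequality. Their product restores the term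
      exactly: for each mass the exponents from \<open>X\<close> and from the root in
      \<open>Y\<close> add up to \<open>1\<close>, and the factors of \<open>rho\<close> and of the
      entropy functions cancel.\<close>
    define X where "X = ms R powr (1 / conj_exp p) * mw R powr (1 / q) / ml R powr (1 - \<alpha> / d)
      * rs R powr (1 / p) * \<epsilon> (rs R) * rw R powr (1 / q') * \<epsilon>' (rw R)"
    have X: "X \<le> b" using bl(3) unfolding X_def d_def .
    define Y where "Y = (ms R / (rs R * \<epsilon> (rs R) powr p)) powr (1 / p) * (fi R / ms R)
      * ((mw R / (rw R * \<epsilon>' (rw R) powr q')) powr (1 / q') * (gi R / mw R))"
    have Y0: "0 \<le> Y" unfolding Y_def using R(2,3) fi0[of R] gi0[of R] by simp
    have e1: "(ms R / (rs R * \<epsilon> (rs R) powr p)) powr (1 / p) = ms R powr (1 / p) / (rs R powr (1 / p) * \<epsilon> (rs R))"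
      using R rs1 e pq by (simp add: powr_divide powr_mult powr_powr)
    have e2: "(mw R / (rw R * \<epsilon>' (rw R) powr q')) powr (1 / q') = mw R powr (1 / q') / (rw R powr (1 / q') * \<epsilon>' (rw R))"
      using R rw1 e q' by (simp add: powr_divide powr_mult powr_powr)
    have e3: "ms R powr (1 / p) * ms R powr (1 / conj_exp p) = ms R"
      using R pq by (simp add: inverse_conj_exp flip: powr_add)
    have e4: "mw R powr (1 / q') * mw R powr (1 / q) = mw R"
      using R q1 by (simp add: q'_def inverse_conj_exp flip: powr_add)
    have e5: "ml R powr (\<alpha> / d) / ml R = 1 / ml R powr (1 - \<alpha> / d)"
      using m by (simp add: powr_diff)
    have "X * Y = (ms R powr (1 / p) * ms R powr (1 / conj_exp p)) * (mw R powr (1 / q') * mw R powr (1 / q))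
        * (fi R / ms R) * (gi R / mw R) * (1 / ml R powr (1 - \<alpha> / d))"
      unfolding X_def Y_def e1 e2 using e rs1 rw1 by (simp add: field_simps)
    also have "\<dots> = fi R * gi R * (ml R powr (\<alpha> / d) / ml R)"
      unfolding e3 e4 e5 using R by simp
    also have "\<dots> = l R * (ml R powr (\<alpha> / d) * gi R)" unfolding l_def by simp
    finally have "l R * (ml R powr (\<alpha> / d) * gi R) = X * Y" by simp
    also have "\<dots> \<le> b * Y" using X Y0 by (rule mult_right_mono)
    finally show "l R * (ml R powr (\<alpha> / d) * gi R) \<le> b * ((ms R / (rs R * \<epsilon> (rs R) powr p)) powr (1 / p) * (fi R / ms R)
      * ((mw R / (rw R * \<epsilon>' (rw R) powr q')) powr (1 / q') * (gi R / mw R)))" unfolding Y_def .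
  qed
  also have "\<dots> = b * (\<Sum>R\<in>T. (ms R / (rs R * \<epsilon> (rs R) powr p)) powr (1 / p) * (fi R / ms R)
      * ((mw R / (rw R * \<epsilon>' (rw R) powr q')) powr (1 / q') * (gi R / mw R)))"
    by (simp add: sum_distrib_left)
  finally have main2: "(\<Sum>R\<in>S. l R * (ml R powr (\<alpha> / d) * gi R)) \<le> \<dots>" .
  have rfin: "rho \<sigma> (closure R) < \<infinity>" "rho w (closure R) < \<infinity>" if "R \<in> T" for R
  proof -
    have R: "R \<in> dyadic_grid A" "0 < ms R" "0 < mw R" using Tg that unfolding T_def by auto
    show "rho \<sigma> (closure R) < \<infinity>" "rho w (closure R) < \<infinity>"
      using beta_le(1,2)[OF \<sigma> w R(1) B R(2,3)[unfolded ms_def mw_def]] by auto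
  qed
  have ET: "E P \<subseteq> P" "E P \<in> sets lebesgue" "measure lebesgue P \<le> 2 * measure lebesgue (E P)" if "P \<in> T" for P
    using E1 E2 E4 that TS by auto
  have ET3: "disjoint_family_on E T" using disjoint_family_on_mono[OF TS E3] .
  define If where "If = (LINT x|weight_measure \<sigma>. f x powr p)"
  define Ig where "Ig = (LINT x|weight_measure w. g x powr q')"
  have Cf: "(\<Sum>R\<in>T. ms R / (rs R * \<epsilon> (rs R) powr p) * (fi R / ms R) powr p) \<le> Carleson_const p \<epsilon> * If"
    unfolding ms_def rs_def fi_def If_def
    by (rule entropy_Carleson_embedding[OF \<sigma> ent(1) pq(1) finT Tg, of E])
      (use ET ET3 rfin f fint Tg in \<open>auto simp: T_def ms_def\<close>)
  have Cg: "(\<Sum>R\<in>T. mw R / (rw R * \<epsilon>' (rw R) powr q') * (gi R / mw R) powr q') \<le> Carleson_const q' \<epsilon>' * Ig"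
    unfolding mw_def rw_def gi_def Ig_def
    by (rule entropy_Carleson_embedding[OF w ent(2)[folded q'_def] q' finT Tg, of E])
      (use ET ET3 rfin g gint Tg in \<open>auto simp: T_def mw_def q'_def\<close>)
  \<comment> \<open>Raising the two factors of Hoelder's inequality to the powers \<open>p\<close>
    and \<open>q'\<close> turns them into the summands of the two Carleson sums.\<close>
  have aux: "(X powr (1 / t) * Y) powr t = X * Y powr t" if "0 \<le> X" "0 \<le> Y" "1 < t" for X Y t :: real
    using that by (simp add: powr_mult powr_powr)
  have eqf: "((ms R / (rs R * \<epsilon> (rs R) powr p)) powr (1 / p) * (fi R / ms R)) powr p
      = ms R / (rs R * \<epsilon> (rs R) powr p) * (fi R / ms R) powr p" for R
    using pq fi0[of R] by (intro aux) (auto simp: ms_def rs_def)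
  have eqg: "((mw R / (rw R * \<epsilon>' (rw R) powr q')) powr (1 / q') * (gi R / mw R)) powr q'
      = mw R / (rw R * \<epsilon>' (rw R) powr q') * (gi R / mw R) powr q'" for R
    using q' gi0[of R] by (intro aux) (auto simp: mw_def rw_def)
  have "(\<Sum>R\<in>T. (ms R / (rs R * \<epsilon> (rs R) powr p)) powr (1 / p) * (fi R / ms R)
      * ((mw R / (rw R * \<epsilon>' (rw R) powr q')) powr (1 / q') * (gi R / mw R)))
    \<le> (\<Sum>R\<in>T. ms R / (rs R * \<epsilon> (rs R) powr p) * (fi R / ms R) powr p) powr (1 / p)
      * (\<Sum>R\<in>T. mw R / (rw R * \<epsilon>' (rw R) powr q') * (gi R / mw R) powr q') powr (1 / q')"
    unfolding eqf[symmetric] eqg[symmetric]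
    unfolding q'_def using fi0 gi0 pq by (intro Holder_sum[OF finT pq]) (auto simp: ms_def mw_def)
  also have "\<dots> \<le> (Carleson_const p \<epsilon> * If) powr (1 / p) * (Carleson_const q' \<epsilon>' * Ig) powr (1 / q')"
    using Cf Cg pq q' by (intro mult_mono powr_mono2 sum_nonneg) (auto simp: ms_def mw_def rs_def rw_def)
  also have "\<dots> = Carleson_const p \<epsilon> powr (1 / p) * Carleson_const q' \<epsilon>' powr (1 / q') * If powr (1 / p) * Ig powr (1 / q')"
  proof -
    have "0 \<le> Carleson_const s e" if "1 < s" for s e
      unfolding Carleson_const_def using that by (intro mult_nonneg_nonneg) (auto intro: add_nonneg_nonneg)
    moreover have "0 \<le> If" "0 \<le> Ig" unfolding If_def Ig_def by (auto intro: integral_nonneg_AE)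
    ultimately show ?thesis using pq(1) q' by (simp add: powr_mult)
  qed
  finally have main3: "(\<Sum>R\<in>T. (ms R / (rs R * \<epsilon> (rs R) powr p)) powr (1 / p) * (fi R / ms R)
      * ((mw R / (rw R * \<epsilon>' (rw R) powr q')) powr (1 / q') * (gi R / mw R))) \<le> \<dots>" .
  have "(\<Sum>Q\<in>F. ml Q powr (\<alpha> / d - 1) * fi Q * gi Q) \<le> 2 * c * (b *
      (Carleson_const p \<epsilon> powr (1 / p) * Carleson_const q' \<epsilon>' powr (1 / q') * If powr (1 / p) * Ig powr (1 / q')))"
    using main1 mult_left_mono[OF main2, of "2 * c"] mult_left_mono[OF mult_left_mono[OF main3 b0], of "2 * c"] c0 by linarith
  then show ?thesis unfolding ml_def fi_def gi_def c_def b_def If_def Ig_def q'_def by (simp add: mult_ac)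
qed

section \<open>Dyadic domination and the strong type bound\<close>

text \<open>Finite stages of an enumeration of the grid, increasing in \<open>N\<close>: estimates
  uniform in \<open>N\<close> pass to the whole grid by monotone convergence.\<close>

definition grid_prefix :: "'n set \<Rightarrow> nat \<Rightarrow> (real ^ 'n) set set" where
  "grid_prefix A N = from_nat_into (dyadic_grid A) ` {..<N}"

lemma finite_grid_prefix: "finite (grid_prefix A N)"
  unfolding grid_prefix_def by simp

lemma grid_prefix_subset: "grid_prefix A N \<subseteq> dyadic_grid A"
proof -
  have "dyadic_grid A \<noteq> {}" unfolding dyadic_grid_def by blast
  then show ?thesis unfolding grid_prefix_def by (auto intro: from_nat_into)
qed

lemma grid_prefix_mono: "N \<le> N' \<Longrightarrow> grid_prefix A N \<subseteq> grid_prefix A N'"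
  unfolding grid_prefix_def by (intro image_mono) auto

lemma grid_prefix_exhausts:
  fixes A :: "'n::finite set"
  assumes "Q \<in> dyadic_grid A"
  shows "\<exists>N. Q \<in> grid_prefix A N"
proof -
  obtain i where "from_nat_into (dyadic_grid A) i = Q"
    using from_nat_into_surj[OF countable_dyadic_grid assms] by blast
  then show ?thesis unfolding grid_prefix_def by (intro exI[of _ "Suc i"]) auto
qed

text \<open>A cube of side at most \<open>6 * norm (y - x)\<close> containing both points alone
  contributes enough, since \<open>\<alpha> / n - 1\<close> is a negative power of the volume. On
  the diagonal the left side is \<open>0\<close> through division by zero.\<close>

lemma kernel_le_dyadic:
  fixes x y :: "real ^ 'n::finite"
  assumes "0 < \<alpha>" "\<alpha> < real CARD('n)"
  shows "ennreal (1 / norm (y - x) powr (real CARD('n) - \<alpha>))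
    \<le> ennreal (6 powr (real CARD('n) - \<alpha>)) * (SUP N. \<Sum>A\<in>UNIV. \<Sum>Q\<in>grid_prefix A N.
        ennreal (measure lebesgue Q powr (\<alpha> / real CARD('n) - 1)) * indicator Q x * indicator Q y)"
    (is "_ \<le> _ * (SUP N. ?S N)")
proof (cases "x = y")
  case False
  define d where "d = real CARD('n)"
  obtain A k m where Q: "x \<in> dyadic_cube A k m" "y \<in> dyadic_cube A k m" "2 powr - real_of_int k \<le> 6 * norm (y - x)"
    using common_dyadic_cube[OF False] by metis
  let ?Q = "dyadic_cube A k m"
  have "?Q \<in> dyadic_grid A" unfolding dyadic_grid_def by blast
  then obtain N where N: "?Q \<in> grid_prefix A N" using grid_prefix_exhausts by blast
  have d: "0 < d" "\<alpha> < d" unfolding d_def using assms(2) by auto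
  have e1: "measure lebesgue ?Q powr (\<alpha> / d - 1) = (2 powr - real_of_int k) powr (- (d - \<alpha>))"
    unfolding measure_dyadic_cube using d
    by (simp add: powr_powr right_diff_distrib flip: powr_realpow d_def)
  have "1 / norm (y - x) powr (d - \<alpha>) = norm (y - x) powr (- (d - \<alpha>))" by (rule powr_minus_divide[symmetric])
  also have "\<dots> \<le> (2 powr - real_of_int k / 6) powr (- (d - \<alpha>))"
    using Q(3) d by (intro powr_mono2') auto
  also have "\<dots> = 6 powr (d - \<alpha>) * (2 powr - real_of_int k) powr (- (d - \<alpha>))"
  proof -
    have "6 powr (d - \<alpha>) * 6 powr (- (d - \<alpha>)) = (1 :: real)" by (simp only: powr_add[symmetric]) simp
    then show ?thesis by (subst powr_divide) (auto simp: divide_simps)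
  qed
  also have "\<dots> = 6 powr (d - \<alpha>) * measure lebesgue ?Q powr (\<alpha> / d - 1)" unfolding e1 ..
  finally have "ennreal (1 / norm (y - x) powr (d - \<alpha>))
      \<le> ennreal (6 powr (d - \<alpha>)) * ennreal (measure lebesgue ?Q powr (\<alpha> / d - 1))"
    by (simp add: ennreal_leI flip: ennreal_mult)
  also have "ennreal (measure lebesgue ?Q powr (\<alpha> / d - 1))
      = (\<Sum>Q\<in>{?Q}. ennreal (measure lebesgue Q powr (\<alpha> / d - 1)) * indicator Q x * indicator Q y)"
    using Q by simp
  also have "\<dots> \<le> (\<Sum>Q\<in>grid_prefix A N. ennreal (measure lebesgue Q powr (\<alpha> / d - 1)) * indicator Q x * indicator Q y)"
    using N by (intro sum_mono2 finite_grid_prefix) auto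
  also have "\<dots> \<le> ?S N"
    unfolding d_def by (rule member_le_sum[where f = "\<lambda>A. \<Sum>Q\<in>grid_prefix A N. _ A Q"]) auto
  also have "\<dots> \<le> (SUP N. ?S N)" by (rule SUP_upper) simp
  finally show ?thesis unfolding d_def by (simp add: mult_left_mono)
qed simp

text \<open>The kernel bound integrated against \<open>h\<close>. The truncations increase with
  \<open>N\<close>, so monotone convergence moves the supremum outside the integral.\<close>

lemma fractional_integral_le_dyadic:
  fixes x :: "real ^ 'n::finite" and h :: "real ^ 'n \<Rightarrow> ennreal"
  assumes "0 < \<alpha>" "\<alpha> < real CARD('n)" and h: "h \<in> borel_measurable lebesgue"
  shows "(\<integral>\<^sup>+y. h y * ennreal (1 / norm (y - x) powr (real CARD('n) - \<alpha>)) \<partial>lebesgue)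
    \<le> ennreal (6 powr (real CARD('n) - \<alpha>)) * (SUP N. \<Sum>A\<in>UNIV. \<Sum>Q\<in>grid_prefix A N.
        ennreal (measure lebesgue Q powr (\<alpha> / real CARD('n) - 1)) * indicator Q x * (\<integral>\<^sup>+y\<in>Q. h y \<partial>lebesgue))"
proof -
  define c where "c Q = ennreal (measure lebesgue Q powr (\<alpha> / real CARD('n) - 1))" for Q :: "(real ^ 'n) set"
  define C where "C = ennreal (6 powr (real CARD('n) - \<alpha>))"
  define S where "S N y = (\<Sum>A\<in>UNIV. \<Sum>Q\<in>grid_prefix A N. c Q * indicator Q x * indicator Q y)" for N y
  have Qm: "Q \<in> sets lebesgue" if "Q \<in> grid_prefix A N" for Q A N
    using that grid_prefix_subset sets_grid by blast
  have Sm: "S N \<in> borel_measurable lebesgue" for N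
    unfolding S_def using Qm
    by (intro borel_measurable_sum borel_measurable_times_ennreal borel_measurable_indicator borel_measurable_const) auto
  have inc: "incseq (\<lambda>N y. h y * S N y)"
    unfolding S_def by (intro incseq_SucI le_funI mult_left_mono sum_mono sum_mono2 finite_grid_prefix grid_prefix_mono) auto
  have "(\<integral>\<^sup>+y. h y * ennreal (1 / norm (y - x) powr (real CARD('n) - \<alpha>)) \<partial>lebesgue)
      \<le> (\<integral>\<^sup>+y. C * (SUP N. h y * S N y) \<partial>lebesgue)"
  proof (rule nn_integral_mono)
    fix y
    have "h y * ennreal (1 / norm (y - x) powr (real CARD('n) - \<alpha>)) \<le> h y * (C * (SUP N. S N y))"
      unfolding C_def S_def c_def by (intro mult_left_mono kernel_le_dyadic assms) auto
    also have "\<dots> = C * (SUP N. h y * S N y)"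
      by (simp add: SUP_mult_left_ennreal mult_ac)
    finally show "h y * ennreal (1 / norm (y - x) powr (real CARD('n) - \<alpha>)) \<le> C * (SUP N. h y * S N y)" .
  qed
  also have "\<dots> = C * (SUP N. \<integral>\<^sup>+y. h y * S N y \<partial>lebesgue)"
    using h Sm inc by (simp add: nn_integral_cmult nn_integral_monotone_convergence_SUP)
  also have "(\<lambda>N. \<integral>\<^sup>+y. h y * S N y \<partial>lebesgue)
      = (\<lambda>N. \<Sum>A\<in>UNIV. \<Sum>Q\<in>grid_prefix A N. c Q * indicator Q x * (\<integral>\<^sup>+y\<in>Q. h y \<partial>lebesgue))"
  proof
    fix N
    have "(\<integral>\<^sup>+y. h y * S N y \<partial>lebesgue)
        = (\<integral>\<^sup>+y. (\<Sum>A\<in>UNIV. \<Sum>Q\<in>grid_prefix A N. (c Q * indicator Q x) * (h y * indicator Q y)) \<partial>lebesgue)"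
      unfolding S_def by (simp add: sum_distrib_left mult_ac)
    also have "\<dots> = (\<Sum>A\<in>UNIV. \<integral>\<^sup>+y. (\<Sum>Q\<in>grid_prefix A N. (c Q * indicator Q x) * (h y * indicator Q y)) \<partial>lebesgue)"
      using h Qm by (intro nn_integral_sum borel_measurable_sum borel_measurable_times_ennreal
          borel_measurable_indicator borel_measurable_const) auto
    also have "\<dots> = (\<Sum>A\<in>UNIV. \<Sum>Q\<in>grid_prefix A N. \<integral>\<^sup>+y. (c Q * indicator Q x) * (h y * indicator Q y) \<partial>lebesgue)"
      using h Qm by (intro sum.cong refl nn_integral_sum borel_measurable_times_ennreal
          borel_measurable_indicator borel_measurable_const) auto
    also have "\<dots> = (\<Sum>A\<in>UNIV. \<Sum>Q\<in>grid_prefix A N. c Q * indicator Q x * (\<integral>\<^sup>+y\<in>Q. h y \<partial>lebesgue))"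
      using h Qm by (intro sum.cong refl nn_integral_cmult borel_measurable_times_ennreal borel_measurable_indicator) auto
    finally show "(\<integral>\<^sup>+y. h y * S N y \<partial>lebesgue) = \<dots>" .
  qed
  finally show ?thesis unfolding C_def c_def .
qed

section \<open>Powers of suprema\<close>

lemma SUP_ennreal_powr_le:
  fixes a :: "nat \<Rightarrow> real"
  assumes "\<And>i. 0 \<le> a i" "0 < q" "0 \<le> r" "(SUP i. ennreal (a i powr q)) \<le> ennreal r"
  shows "(SUP i. ennreal (a i)) \<le> ennreal (r powr (1 / q))"
proof (rule SUP_least)
  fix i
  have "ennreal (a i powr q) \<le> ennreal r"
    using assms(4) by (rule order_trans[OF SUP_upper, rotated]) simp
  then have "a i powr q \<le> r" using assms(3) by simp
  then have "(a i powr q) powr (1 / q) \<le> r powr (1 / q)" using assms(2) by (intro powr_mono2) auto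
  then show "ennreal (a i) \<le> ennreal (r powr (1 / q))"
    using assms(1)[of i] assms(2) by (simp add: powr_powr ennreal_leI)
qed

lemma ennreal_powr_le_SUP:
  fixes a :: "nat \<Rightarrow> real"
  assumes "\<And>i. 0 \<le> a i" "0 < q" "0 \<le> y" "ennreal y \<le> (SUP i. ennreal (a i))"
  shows "ennreal (y powr q) \<le> (SUP i. ennreal (a i powr q))"
\<comment> \<open>If the claim fails, the supremum of the powers lies below a real number and is
  itself a finite \<open>r\<close>; the previous lemma then bounds \<open>y\<close> by
  \<open>r powr (1 / q)\<close>. The case of an infinite supremum is thereby covered.\<close>
proof (rule ccontr)
  assume *: "\<not> ?thesis"
  define s where "s = (SUP i. ennreal (a i powr q))"
  have "s < ennreal (y powr q)" using * unfolding s_def by simp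
  then obtain r where r: "0 \<le> r" "s = ennreal r" by (cases s) auto
  have "r < y powr q" using \<open>s < _\<close> r by (simp add: ennreal_less_iff)
  have "ennreal y \<le> ennreal (r powr (1 / q))"
    using SUP_ennreal_powr_le[of a q r] assms r unfolding s_def by (metis order_refl order_trans)
  then have "y \<le> r powr (1 / q)" by simp
  then have "y powr q \<le> (r powr (1 / q)) powr q" using assms by (intro powr_mono2) auto
  also have "\<dots> = r" using r assms by (simp add: powr_powr)
  finally show False using \<open>r < _\<close> by simp
qed

text \<open>All shifted grids are summed because the grid that captures a close pair of points
  depends on the pair. The truncation keeps the values real.\<close>

definition dyadic_operator ::
    "real \<Rightarrow> (real ^ 'n::finite \<Rightarrow> real) \<Rightarrow> (real ^ 'n \<Rightarrow> real) \<Rightarrow> nat \<Rightarrow> real ^ 'n \<Rightarrow> real" where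
  "dyadic_operator \<alpha> \<sigma> f N x = (\<Sum>A\<in>UNIV. \<Sum>Q\<in>grid_prefix A N.
     measure lebesgue Q powr (\<alpha> / real CARD('n) - 1) * (LINT y:Q|weight_measure \<sigma>. f y) * indicator Q x)"

text \<open>The bilinear bound is tested on \<open>g = J powr (q - 1)\<close>, for which
  \<open>J * g\<close> and \<open>g powr q'\<close> both equal \<open>J powr q\<close>. With
  \<open>X\<close> the integral of \<open>J powr q\<close> it reads
  \<open>X \<le> D * X powr (1 / q')\<close>, and division gives the claim. The factor
  \<open>CARD('n set)\<close> counts the choices of shifted coordinates.\<close>

lemma dyadic_operator_strong_type:
  fixes f :: "real ^ 'n::finite \<Rightarrow> real" and N :: nat
  assumes \<alpha>: "0 < \<alpha>" and pq: "1 < p" "p \<le> q"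
    and ent: "entropy_function p \<epsilon>" "entropy_function (conj_exp q) \<epsilon>'"
    and \<sigma>: "is_weight \<sigma>" and w: "is_weight w"
    and B: "entropy_bracket \<alpha> p q \<epsilon> \<epsilon>' \<sigma> w < \<infinity>"
    and f: "\<And>x. 0 \<le> f x" "f \<in> borel_measurable lebesgue" "integrable (weight_measure \<sigma>) (\<lambda>x. f x powr p)"
  defines "J \<equiv> dyadic_operator \<alpha> \<sigma> f N"
  defines "D \<equiv> real CARD('n set) * (2 / (1 - 2 powr - \<alpha>) * Carleson_const p \<epsilon> powr (1 / p) * Carleson_const (conj_exp q) \<epsilon>' powr (1 / conj_exp q)
      * enn2real (entropy_bracket \<alpha> p q \<epsilon> \<epsilon>' \<sigma> w)
      * (LINT x|weight_measure \<sigma>. f x powr p) powr (1 / p))"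
  shows "integrable (weight_measure w) (\<lambda>x. J x powr q)" "(LINT x|weight_measure w. J x powr q) \<le> D powr q"
proof -
  define d where "d = real CARD('n)"
  define q' where "q' = conj_exp q"
  have q1: "1 < q" using pq by simp
  have q': "1 < q'" unfolding q'_def using conj_exp_gt_1[OF q1] .
  have qq: "(q - 1) * q' = q" unfolding q'_def conj_exp_def using q1 by simp
  define k where "k Q = measure lebesgue Q powr (\<alpha> / d - 1) * (LINT y:Q|weight_measure \<sigma>. f y)" for Q
  have k0: "0 \<le> k Q" for Q
    unfolding k_def set_lebesgue_integral_def using f(1) by (intro mult_nonneg_nonneg integral_nonneg_AE) auto
  have J: "J = (\<lambda>x. \<Sum>A\<in>UNIV. \<Sum>Q\<in>grid_prefix A N. k Q * indicator Q x)"
    unfolding J_def dyadic_operator_def k_def d_def ..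
  have J0: "0 \<le> J x" for x unfolding J using k0 by (intro sum_nonneg) auto
  have Qg: "Q \<in> dyadic_grid A" if "Q \<in> grid_prefix A N" for Q A using that grid_prefix_subset by blast
  have Qm: "Q \<in> sets lebesgue" if "Q \<in> grid_prefix A N" for Q A using Qg[OF that] by (rule sets_grid)
  have Jm: "J \<in> borel_measurable lebesgue"
    unfolding J using Qm by (intro borel_measurable_sum borel_measurable_times borel_measurable_indicator borel_measurable_const) auto
  \<comment> \<open>\<open>J\<close> is bounded and vanishes off the bounded set \<open>U\<close>,
    so its positive powers are integrable for \<open>w\<close>. This makes \<open>X\<close> the true
    finite integral and permits dividing by \<open>X powr (1 / q')\<close>.\<close>
  define U where "U = (\<Union>A\<in>(UNIV :: 'n set set). \<Union>Q\<in>grid_prefix A N. Q)"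
  have Um: "U \<in> sets lebesgue"
    unfolding U_def using Qm by (intro sets.finite_UN finite_grid_prefix) auto
  have Ufin: "emeasure (weight_measure w) U < \<infinity>"
  proof (rule emeasure_weight_measure_finite[OF w Um])
    show "bounded U" unfolding U_def using bounded_grid[OF Qg] by (intro bounded_UN finite_grid_prefix ballI finite)
  qed
  define b where "b = (\<Sum>A\<in>(UNIV :: 'n set set). \<Sum>Q\<in>grid_prefix A N. k Q)"
  have Jb: "J x \<le> b * indicator U x" for x
  proof (cases "x \<in> U")
    case True
    have "J x \<le> b" unfolding J b_def using k0 by (intro sum_mono) (auto simp: indicator_def)
    then show ?thesis using True by simp
  next
    case False
    then have "J x = 0" unfolding J U_def by (intro sum.neutral ballI) auto
    then show ?thesis using False by simp
  qed
  have int: "integrable (weight_measure w) (\<lambda>x. J x powr r)" if "0 < r" for r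
  proof (rule Bochner_Integration.integrable_bound)
    show "integrable (weight_measure w) (\<lambda>x. b powr r * indicator U x)"
      using Um Ufin by (intro integrable_mult_right integrable_real_indicator) auto
    have "(\<lambda>x. J x powr r) \<in> borel_measurable lebesgue" using Jm by measurable
    then show "(\<lambda>x. J x powr r) \<in> borel_measurable (weight_measure w)" by (simp cong: measurable_cong_sets)
    have "J x powr r \<le> b powr r * indicator U x" for x
      using Jb[of x] J0[of x] that by (cases "x \<in> U") (auto intro: powr_mono2)
    then show "AE x in weight_measure w. norm (J x powr r) \<le> norm (b powr r * indicator U x)"
      by (intro AE_I2) (auto simp: abs_mult)
  qed
  show "integrable (weight_measure w) (\<lambda>x. J x powr q)" using int q1 by simp
  define X where "X = (LINT x|weight_measure w. J x powr q)"
  define g where "g x = J x powr (q - 1)" for x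
  have g0: "0 \<le> g x" for x unfolding g_def by simp
  have gm: "g \<in> borel_measurable lebesgue" unfolding g_def using Jm by measurable
  have gq: "g x powr q' = J x powr q" for x unfolding g_def by (simp add: powr_powr qq)
  have gint: "integrable (weight_measure w) (\<lambda>x. g x powr conj_exp q)"
    using int[of q] q1 unfolding q'_def[symmetric] gq by simp
  have gset: "integrable (weight_measure w) (\<lambda>x. indicator Q x * g x)" if "Q \<in> grid_prefix A N" for Q A
    using int[of "q - 1"] q1 Qm[OF that] integrable_mult_indicator[of Q "weight_measure w" g]
    unfolding g_def by simp
  have "X = (LINT x|weight_measure w. (\<Sum>A\<in>UNIV. \<Sum>Q\<in>grid_prefix A N. k Q * (indicator Q x * g x)))"
    unfolding X_def
  proof (rule Bochner_Integration.integral_cong[OF refl])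
    fix x
    have "J x powr q = J x * g x"
      using J0[of x] powr_add[of "J x" 1 "q - 1"] unfolding g_def by (cases "J x = 0") auto
    also have "\<dots> = (\<Sum>A\<in>UNIV. \<Sum>Q\<in>grid_prefix A N. k Q * (indicator Q x * g x))"
      unfolding J by (simp only: sum_distrib_right mult.assoc)
    finally show "J x powr q = \<dots>" .
  qed
  also have "\<dots> = (\<Sum>A\<in>UNIV. LINT x|weight_measure w. (\<Sum>Q\<in>grid_prefix A N. k Q * (indicator Q x * g x)))"
    using gset by (intro Bochner_Integration.integral_sum Bochner_Integration.integrable_sum integrable_mult_right) auto
  also have "\<dots> = (\<Sum>A\<in>UNIV. \<Sum>Q\<in>grid_prefix A N. k Q * (LINT x:Q|weight_measure w. g x))"
  proof (rule sum.cong[OF refl])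
    fix A :: "'n set"
    have "(LINT x|weight_measure w. (\<Sum>Q\<in>grid_prefix A N. k Q * (indicator Q x * g x)))
        = (\<Sum>Q\<in>grid_prefix A N. LINT x|weight_measure w. k Q * (indicator Q x * g x))"
      using gset by (intro Bochner_Integration.integral_sum integrable_mult_right) auto
    then show "(LINT x|weight_measure w. (\<Sum>Q\<in>grid_prefix A N. k Q * (indicator Q x * g x)))
        = (\<Sum>Q\<in>grid_prefix A N. k Q * (LINT x:Q|weight_measure w. g x))"
      by (simp add: set_lebesgue_integral_def)
  qed
  also have "\<dots> \<le> (\<Sum>A\<in>(UNIV :: 'n set set). 2 / (1 - 2 powr - \<alpha>) * Carleson_const p \<epsilon> powr (1 / p) * Carleson_const (conj_exp q) \<epsilon>' powr (1 / conj_exp q)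
      * enn2real (entropy_bracket \<alpha> p q \<epsilon> \<epsilon>' \<sigma> w)
      * (LINT x|weight_measure \<sigma>. f x powr p) powr (1 / p)
      * (LINT x|weight_measure w. g x powr conj_exp q) powr (1 / conj_exp q))"
    unfolding k_def d_def
    by (rule sum_mono, rule dyadic_bilinear_bound[OF \<alpha> pq ent \<sigma> w B finite_grid_prefix grid_prefix_subset f g0 gm gint])
  also have "\<dots> = D * X powr (1 / q')"
    unfolding D_def X_def q'_def[symmetric] gq by simp
  finally have le: "X \<le> D * X powr (1 / q')" .
  have X0: "0 \<le> X" unfolding X_def by (intro integral_nonneg_AE) auto
  show "X \<le> D powr q"
  proof (cases "X = 0")
    case False
    then have X: "0 < X" using X0 by simp
    have "X = X powr (1 / q) * X powr (1 / q')"
      using X q1 by (simp add: q'_def inverse_conj_exp flip: powr_add)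
    with le have "X powr (1 / q) * X powr (1 / q') \<le> D * X powr (1 / q')" by simp
    then have "X powr (1 / q) \<le> D" using X by simp
    then have "(X powr (1 / q)) powr q \<le> D powr q" using q1 by (intro powr_mono2) auto
    then show ?thesis using X q1 by (simp add: powr_powr)
  qed simp
qed

lemma nn_integral_weighted_grid:
  fixes f :: "real ^ 'n::finite \<Rightarrow> real"
  assumes \<sigma>: "is_weight \<sigma>" and Q: "Q \<in> dyadic_grid A" and p: "1 \<le> p"
    and f: "\<And>x. 0 \<le> f x" "f \<in> borel_measurable lebesgue" "integrable (weight_measure \<sigma>) (\<lambda>x. f x powr p)"
  shows "(\<integral>\<^sup>+y\<in>Q. ennreal (\<sigma> y * f y) \<partial>lebesgue) = ennreal (LINT y:Q|weight_measure \<sigma>. f y)"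
proof -
  have Qm: "Q \<in> sets lebesgue" using Q by (rule sets_grid)
  have fm: "f \<in> borel_measurable (weight_measure \<sigma>)" using f(2) by (simp cong: measurable_cong_sets)
  have "set_integrable (weight_measure \<sigma>) Q f"
    using Qm emeasure_weight_measure_finite[OF \<sigma> Qm bounded_grid[OF Q]]
    by (intro set_integrable_of_integrable_powr[OF p f(3) fm f(1)]) auto
  then have "set_integrable lebesgue Q (\<lambda>x. \<sigma> x * f x)"
    using set_integrable_weight_measure[OF \<sigma> f(2) Qm] by simp
  then have i: "integrable lebesgue (\<lambda>x. indicator Q x * (\<sigma> x * f x))" unfolding set_integrable_def by simp
  have "(\<integral>\<^sup>+y\<in>Q. ennreal (\<sigma> y * f y) \<partial>lebesgue) = (\<integral>\<^sup>+y. ennreal (indicator Q y * (\<sigma> y * f y)) \<partial>lebesgue)"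
    by (intro nn_integral_cong) (auto simp: indicator_def)
  also have "\<dots> = ennreal (LINT y|lebesgue. indicator Q y * (\<sigma> y * f y))"
    using i f(1) weight_nonneg[OF \<sigma>] by (intro nn_integral_eq_integral) auto
  also have "(LINT y|lebesgue. indicator Q y * (\<sigma> y * f y)) = (LINT y:Q|weight_measure \<sigma>. f y)"
    using set_integral_weight_measure[OF \<sigma> f(2) Qm] by (simp add: set_lebesgue_integral_def)
  finally show ?thesis .
qed

lemma fractional_potential_le_dyadic_operator:
  fixes f :: "real ^ 'n::finite \<Rightarrow> real"
  assumes \<alpha>: "0 < \<alpha>" "\<alpha> < real CARD('n)" and \<sigma>: "is_weight \<sigma>" and p: "1 \<le> p"
    and f: "\<And>x. 0 \<le> f x" "f \<in> borel_measurable lebesgue" "integrable (weight_measure \<sigma>) (\<lambda>x. f x powr p)"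
  shows "(\<integral>\<^sup>+y. ennreal (\<sigma> y * f y / norm (y - x) powr (real CARD('n) - \<alpha>)) \<partial>lebesgue)
    \<le> (SUP N. ennreal (6 powr (real CARD('n) - \<alpha>) * dyadic_operator \<alpha> \<sigma> f N x))"
proof -
  have hm: "(\<lambda>y. ennreal (\<sigma> y * f y)) \<in> borel_measurable lebesgue"
    using borel_measurable_weight[OF \<sigma>] f(2) by measurable
  have op: "(\<Sum>A\<in>UNIV. \<Sum>Q\<in>grid_prefix A N. ennreal (measure lebesgue Q powr (\<alpha> / real CARD('n) - 1)) * indicator Q x
      * (\<integral>\<^sup>+y\<in>Q. ennreal (\<sigma> y * f y) \<partial>lebesgue)) = ennreal (dyadic_operator \<alpha> \<sigma> f N x)" for N
  proof -
    have fi0: "0 \<le> (LINT y:Q|weight_measure \<sigma>. f y)" for Q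
      unfolding set_lebesgue_integral_def using f(1) by (intro integral_nonneg_AE) auto
    have "(\<Sum>A\<in>UNIV. \<Sum>Q\<in>grid_prefix A N. ennreal (measure lebesgue Q powr (\<alpha> / real CARD('n) - 1)) * indicator Q x
        * (\<integral>\<^sup>+y\<in>Q. ennreal (\<sigma> y * f y) \<partial>lebesgue))
      = (\<Sum>A\<in>UNIV. \<Sum>Q\<in>grid_prefix A N. ennreal (measure lebesgue Q powr (\<alpha> / real CARD('n) - 1)
        * (LINT y:Q|weight_measure \<sigma>. f y) * indicator Q x))"
    proof (intro sum.cong refl)
      fix A and Q :: "(real ^ 'n) set" assume "Q \<in> grid_prefix A N"
      then have "Q \<in> dyadic_grid A" using grid_prefix_subset by blast
      then have "(\<integral>\<^sup>+y\<in>Q. ennreal (\<sigma> y * f y) \<partial>lebesgue) = ennreal (LINT y:Q|weight_measure \<sigma>. f y)"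
        by (rule nn_integral_weighted_grid[OF \<sigma> _ p f])
      then show "ennreal (measure lebesgue Q powr (\<alpha> / real CARD('n) - 1)) * indicator Q x
          * (\<integral>\<^sup>+y\<in>Q. ennreal (\<sigma> y * f y) \<partial>lebesgue)
        = ennreal (measure lebesgue Q powr (\<alpha> / real CARD('n) - 1) * (LINT y:Q|weight_measure \<sigma>. f y) * indicator Q x)"
        using fi0[of Q] by (cases "x \<in> Q") (simp_all add: ennreal_mult)
    qed
    also have "\<dots> = ennreal (dyadic_operator \<alpha> \<sigma> f N x)"
      unfolding dyadic_operator_def using fi0 by (simp add: sum_nonneg)
    finally show ?thesis .
  qed
  have "(\<integral>\<^sup>+y. ennreal (\<sigma> y * f y / norm (y - x) powr (real CARD('n) - \<alpha>)) \<partial>lebesgue)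
      = (\<integral>\<^sup>+y. ennreal (\<sigma> y * f y) * ennreal (1 / norm (y - x) powr (real CARD('n) - \<alpha>)) \<partial>lebesgue)"
    using f(1) weight_nonneg[OF \<sigma>] by (intro nn_integral_cong) (simp flip: ennreal_mult)
  also have "\<dots> \<le> ennreal (6 powr (real CARD('n) - \<alpha>)) * (SUP N. ennreal (dyadic_operator \<alpha> \<sigma> f N x))"
    using fractional_integral_le_dyadic[OF \<alpha> hm, of x] unfolding op .
  also have "\<dots> = (SUP N. ennreal (6 powr (real CARD('n) - \<alpha>) * dyadic_operator \<alpha> \<sigma> f N x))"
    by (simp add: SUP_mult_left_ennreal ennreal_mult')
  finally show ?thesis .
qed

lemma Carleson_const_pos:
  assumes "entropy_function s \<epsilon>" "1 < s"
  shows "0 < Carleson_const s \<epsilon>"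
proof -
  have "0 < \<epsilon> 1" using assms(1) unfolding entropy_function_def by simp
  moreover have "2 powr (1 - s) < 1" using assms(2) by (simp add: powr_less_one)
  ultimately show ?thesis unfolding Carleson_const_def by (intro mult_pos_pos add_pos_pos) auto
qed

lemma Lp_space_cmod:
  fixes f :: "real ^ 'n \<Rightarrow> complex"
  assumes "f \<in> Lp_space p (weight_measure \<sigma>)" "1 < p"
  shows "f \<in> borel_measurable lebesgue" "integrable (weight_measure \<sigma>) (\<lambda>x. cmod (f x) powr p)"
    "Lp_norm p (weight_measure \<sigma>) f = ennreal ((LINT x|weight_measure \<sigma>. cmod (f x) powr p) powr (1 / p))"
proof -
  have fm: "f \<in> borel_measurable (weight_measure \<sigma>)" and fin: "Lp_norm p (weight_measure \<sigma>) f < \<infinity>"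
    using assms(1) unfolding Lp_space_def by auto
  then show "f \<in> borel_measurable lebesgue" by (simp cong: measurable_cong_sets)
  have "(\<integral>\<^sup>+x. ennreal (cmod (f x) powr p) \<partial>weight_measure \<sigma>) < \<infinity>"
    using fin unfolding Lp_norm_def ennreal_powr_def by (auto simp: less_top split: if_splits)
  moreover have "(\<lambda>x. cmod (f x) powr p) \<in> borel_measurable (weight_measure \<sigma>)" using fm by measurable
  ultimately show i: "integrable (weight_measure \<sigma>) (\<lambda>x. cmod (f x) powr p)"
    by (intro integrableI_bounded) auto
  have "(\<integral>\<^sup>+x. ennreal (cmod (f x) powr p) \<partial>weight_measure \<sigma>) = ennreal (LINT x|weight_measure \<sigma>. cmod (f x) powr p)"
    using i by (intro nn_integral_eq_integral) auto
  then show "Lp_norm p (weight_measure \<sigma>) f = ennreal ((LINT x|weight_measure \<sigma>. cmod (f x) powr p) powr (1 / p))"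
    unfolding Lp_norm_def ennreal_powr_def by (simp add: integral_nonneg_AE)
qed

section \<open>Passage to the fractional integral\<close>

theorem theorem1p4:
  fixes \<alpha> :: real
  assumes "0 < \<alpha>" "\<alpha> < real CARD('n::finite)"
  shows
    "\<exists>C\<^sub>\<alpha>\<^sub>n > 0 :: real. \<forall>(p::real) (q::real) (\<epsilon>::real \<Rightarrow> real) (\<epsilon>'::real \<Rightarrow> real).
       1 < p \<longrightarrow> p \<le> q \<longrightarrow> entropy_function p \<epsilon> \<longrightarrow> entropy_function (conj_exp q) \<epsilon>' \<longrightarrow>
       (\<exists>C > 0 :: real.
          \<forall>(\<sigma> :: real ^ 'n \<Rightarrow> real) (w :: real ^ 'n \<Rightarrow> real) (f :: real ^ 'n \<Rightarrow> complex).
            is_weight \<sigma> \<longrightarrow> is_weight w \<longrightarrow> entropy_bracket \<alpha> p q \<epsilon> \<epsilon>' \<sigma> w < \<infinity> \<longrightarrow>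
            f \<in> Lp_space p (weight_measure \<sigma>) \<longrightarrow>
              (AE x in weight_measure w. frac_integral_converges \<alpha> (\<lambda>y. \<sigma> y *\<^sub>R f y) x) \<and>
              Lp_norm q (weight_measure w) (frac_integral \<alpha> (\<lambda>y. \<sigma> y *\<^sub>R f y))
                \<le> ennreal C * ennreal C\<^sub>\<alpha>\<^sub>n * entropy_bracket \<alpha> p q \<epsilon> \<epsilon>' \<sigma> w
                    * Lp_norm p (weight_measure \<sigma>) f)"
proof -
  define c where "c = 6 powr (real CARD('n) - \<alpha>)"
  \<comment> \<open>The kernel constant, the number of grids, and the factor from freezing averages
    and summing generations: only \<open>\<alpha>\<close> and \<open>n\<close> enter.\<close>
  define K where "K = c * (real CARD('n set) * (2 / (1 - 2 powr - \<alpha>)))"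
  have c0: "0 < c" unfolding c_def by simp
  have K0: "0 < K" unfolding K_def using c0 assms(1) by (intro mult_pos_pos divide_pos_pos) (auto simp: powr_less_one)
  show ?thesis
  proof (rule exI[of _ K], intro conjI K0 allI impI)
    fix p q :: real and \<epsilon> \<epsilon>' :: "real \<Rightarrow> real"
    assume pq: "1 < p" "p \<le> q" and ent: "entropy_function p \<epsilon>" "entropy_function (conj_exp q) \<epsilon>'"
    have q1: "1 < q" using pq by simp
    \<comment> \<open>The two Carleson constants, fixed before the weights and \<open>f\<close> are
      chosen.\<close>
    define C where "C = Carleson_const p \<epsilon> powr (1 / p) * Carleson_const (conj_exp q) \<epsilon>' powr (1 / conj_exp q)"
    have C0: "0 < C"
      unfolding C_def using Carleson_const_pos[OF ent(1) pq(1)] Carleson_const_pos[OF ent(2) conj_exp_gt_1[OF q1]] by simp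
    show "\<exists>C > 0 :: real.
          \<forall>(\<sigma> :: real ^ 'n \<Rightarrow> real) (w :: real ^ 'n \<Rightarrow> real) (f :: real ^ 'n \<Rightarrow> complex).
            is_weight \<sigma> \<longrightarrow> is_weight w \<longrightarrow> entropy_bracket \<alpha> p q \<epsilon> \<epsilon>' \<sigma> w < \<infinity> \<longrightarrow>
            f \<in> Lp_space p (weight_measure \<sigma>) \<longrightarrow>
              (AE x in weight_measure w. frac_integral_converges \<alpha> (\<lambda>y. \<sigma> y *\<^sub>R f y) x) \<and>
              Lp_norm q (weight_measure w) (frac_integral \<alpha> (\<lambda>y. \<sigma> y *\<^sub>R f y))
                \<le> ennreal C * ennreal K * entropy_bracket \<alpha> p q \<epsilon> \<epsilon>' \<sigma> w
                    * Lp_norm p (weight_measure \<sigma>) f"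
    proof (intro exI[of _ C] conjI C0 allI impI)
      fix \<sigma> w :: "real ^ 'n \<Rightarrow> real" and f :: "real ^ 'n \<Rightarrow> complex"
      assume \<sigma>: "is_weight \<sigma>" and w: "is_weight w" and B: "entropy_bracket \<alpha> p q \<epsilon> \<epsilon>' \<sigma> w < \<infinity>"
        and f: "f \<in> Lp_space p (weight_measure \<sigma>)"
      note fL = Lp_space_cmod[OF f pq(1)]
      have fm: "(\<lambda>x. cmod (f x)) \<in> borel_measurable lebesgue" using fL(1) by measurable
      define b where "b = enn2real (entropy_bracket \<alpha> p q \<epsilon> \<epsilon>' \<sigma> w)"
      define If where "If = (LINT x|weight_measure \<sigma>. cmod (f x) powr p)"
      define J where "J = dyadic_operator \<alpha> \<sigma> (\<lambda>x. cmod (f x))"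
      define D where "D = real CARD('n set) * (2 / (1 - 2 powr - \<alpha>) * Carleson_const p \<epsilon> powr (1 / p)
        * Carleson_const (conj_exp q) \<epsilon>' powr (1 / conj_exp q) * b * If powr (1 / p))"
      have J: "integrable (weight_measure w) (\<lambda>x. J N x powr q)" "(LINT x|weight_measure w. J N x powr q) \<le> D powr q" for N
        unfolding J_def D_def b_def If_def
        by (rule dyadic_operator_strong_type[where f = "\<lambda>x. cmod (f x)", OF assms(1) pq ent \<sigma> w B norm_ge_zero fm fL(2)])+
      have J0: "0 \<le> J N x" for N x
        unfolding J_def dyadic_operator_def set_lebesgue_integral_def
        by (intro sum_nonneg mult_nonneg_nonneg integral_nonneg_AE) auto
      have Jinc: "incseq (\<lambda>N. J N x)" for x
        unfolding J_def dyadic_operator_def set_lebesgue_integral_def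
        by (intro incseq_SucI sum_mono sum_mono2 finite_grid_prefix grid_prefix_mono mult_nonneg_nonneg integral_nonneg_AE) auto
      have D0: "0 \<le> D"
        unfolding D_def b_def using assms(1) by (intro mult_nonneg_nonneg divide_nonneg_nonneg) (auto simp: powr_less_one less_imp_le)
      \<comment> \<open>The potential of \<open>|f| \<sigma>\<close> as an extended number. Its
        finiteness at \<open>x\<close> is absolute convergence there, and it dominates the modulus
        of the fractional integral, so estimating it serves both claims.\<close>
      define I where "I x = (\<integral>\<^sup>+y. ennreal (\<sigma> y * cmod (f y) / norm (y - x) powr (real CARD('n) - \<alpha>)) \<partial>lebesgue)" for x
      have I: "I x \<le> (SUP N. ennreal (c * J N x))" for x
        unfolding I_def c_def J_def using pq(1)
        by (intro fractional_potential_le_dyadic_operator[where f = "\<lambda>x. cmod (f x)", OF assms \<sigma> _ norm_ge_zero fm fL(2)]) simp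
      have nrm: "norm (frac_integrand \<alpha> (\<lambda>y. \<sigma> y *\<^sub>R f y) x y) = \<sigma> y * cmod (f y) / norm (y - x) powr (real CARD('n) - \<alpha>)" for x y
        unfolding frac_integrand_def using weight_nonneg[OF \<sigma>] by (simp add: divide_inverse)
      have conv: "frac_integral_converges \<alpha> (\<lambda>y. \<sigma> y *\<^sub>R f y) x" if "I x < \<infinity>" for x
        unfolding frac_integral_converges_def
      proof (rule integrableI_bounded)
        show "frac_integrand \<alpha> (\<lambda>y. \<sigma> y *\<^sub>R f y) x \<in> borel_measurable lebesgue"
        proof -
          have "(\<lambda>y. inverse (norm (y - x) powr (real CARD('n) - \<alpha>))) \<in> borel_measurable lborel" by measurable
          then have "(\<lambda>y. inverse (norm (y - x) powr (real CARD('n) - \<alpha>))) \<in> borel_measurable lebesgue"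
            by (rule measurable_completion)
          then show ?thesis
            unfolding frac_integrand_def[abs_def]
            using borel_measurable_weight[OF \<sigma>] fL(1) by (intro borel_measurable_scaleR)
        qed
        show "(\<integral>\<^sup>+y. ennreal (norm (frac_integrand \<alpha> (\<lambda>y. \<sigma> y *\<^sub>R f y) x y)) \<partial>lebesgue) < \<infinity>"
          unfolding nrm using that unfolding I_def .
      qed
      have bound: "ennreal (norm (frac_integral \<alpha> (\<lambda>y. \<sigma> y *\<^sub>R f y) x)) \<le> I x" for x
      proof (cases "frac_integral_converges \<alpha> (\<lambda>y. \<sigma> y *\<^sub>R f y) x")
        case True
        then show ?thesis
          unfolding frac_integral_def frac_integral_converges_def I_def nrm[symmetric]
          by (rule integral_norm_bound_ennreal)
      next
        \<comment> \<open>A divergent integral has the default value \<open>0\<close>, which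
          satisfies any such bound.\<close>
        case False
        then show ?thesis
          unfolding frac_integral_def frac_integral_converges_def by (simp add: not_integrable_integral_eq)
      qed
      \<comment> \<open>The powers are taken inside the supremum so that monotone convergence
        applies directly; \<open>SUP_ennreal_powr_le\<close> and \<open>ennreal_powr_le_SUP\<close>
        relate \<open>G\<close> to \<open>I\<close>.\<close>
      define G where "G x = (SUP N. ennreal ((c * J N x) powr q))" for x
      have pm: "(c * J N x) powr q = c powr q * J N x powr q" for N x
        using c0 J0[of N x] by (simp add: powr_mult)
      have Jm: "(\<lambda>x. ennreal ((c * J N x) powr q)) \<in> borel_measurable (weight_measure w)" for N
      proof -
        have "(\<lambda>x. c powr q * J N x powr q) \<in> borel_measurable (weight_measure w)"
          using J(1)[of N] by (intro borel_measurable_times borel_measurable_const borel_measurable_integrable)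
        then show ?thesis unfolding pm by (rule measurable_compose[OF _ measurable_ennreal])
      qed
      have "(\<integral>\<^sup>+x. G x \<partial>weight_measure w) = (SUP N. \<integral>\<^sup>+x. ennreal ((c * J N x) powr q) \<partial>weight_measure w)"
        unfolding G_def
      proof (rule nn_integral_monotone_convergence_SUP[OF _ Jm])
        show "incseq (\<lambda>N x. ennreal ((c * J N x) powr q))"
        proof (intro incseq_SucI le_funI ennreal_leI powr_mono2 mult_left_mono)
          show "J N x \<le> J (Suc N) x" for N x using incseq_SucD[OF Jinc] .
        qed (use c0 J0 q1 in simp_all)
      qed
      also have "\<dots> \<le> ennreal ((c * D) powr q)"
      proof (rule SUP_least)
        fix N
        have "(\<integral>\<^sup>+x. ennreal ((c * J N x) powr q) \<partial>weight_measure w) = ennreal (LINT x|weight_measure w. (c * J N x) powr q)"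
          unfolding pm using J(1)[of N] by (intro nn_integral_eq_integral integrable_mult_right AE_I2) simp_all
        also have "(LINT x|weight_measure w. (c * J N x) powr q) = c powr q * (LINT x|weight_measure w. J N x powr q)"
          unfolding pm by (rule integral_mult_right_zero)
        also have "\<dots> \<le> c powr q * D powr q" using J(2) by (intro mult_left_mono) auto
        also have "\<dots> = (c * D) powr q" using c0 D0 by (simp add: powr_mult)
        finally show "(\<integral>\<^sup>+x. ennreal ((c * J N x) powr q) \<partial>weight_measure w) \<le> ennreal ((c * D) powr q)"
          by (simp add: ennreal_leI)
      qed
      finally have Gint: "(\<integral>\<^sup>+x. G x \<partial>weight_measure w) \<le> ennreal ((c * D) powr q)" .
      have Gm: "G \<in> borel_measurable (weight_measure w)"
        unfolding G_def using Jm by (intro borel_measurable_SUP) auto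
      have "(\<integral>\<^sup>+x. G x \<partial>weight_measure w) \<noteq> \<infinity>" using Gint by (auto simp: top_unique)
      then have "AE x in weight_measure w. G x \<noteq> \<infinity>" using Gm by (rule nn_integral_PInf_AE[rotated])
      then show "AE x in weight_measure w. frac_integral_converges \<alpha> (\<lambda>y. \<sigma> y *\<^sub>R f y) x"
      proof (rule AE_mp, intro AE_I2 impI)
        \<comment> \<open>A finite \<open>G x\<close> bounds the sequence \<open>c * J N x\<close>
          and hence \<open>I x\<close>; almost every \<open>x\<close> qualifies because
          \<open>G\<close> has a finite integral.\<close>
        fix x assume "G x \<noteq> \<infinity>"
        then obtain r where r: "0 \<le> r" "G x = ennreal r" by (cases "G x") auto
        have "(SUP N. ennreal (c * J N x)) \<le> ennreal (r powr (1 / q))"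
          using r c0 J0 q1 unfolding G_def by (intro SUP_ennreal_powr_le) auto
        with I[of x] have "I x \<le> ennreal (r powr (1 / q))" by (rule order_trans)
        then have "I x < \<infinity>" by (auto simp: less_top[symmetric] top_unique)
        then show "frac_integral_converges \<alpha> (\<lambda>y. \<sigma> y *\<^sub>R f y) x" by (rule conv)
      qed
      have "(\<integral>\<^sup>+x. ennreal (norm (frac_integral \<alpha> (\<lambda>y. \<sigma> y *\<^sub>R f y) x) powr q) \<partial>weight_measure w) \<le> (\<integral>\<^sup>+x. G x \<partial>weight_measure w)"
        unfolding G_def using c0 J0 q1 order_trans[OF bound I]
        by (intro nn_integral_mono ennreal_powr_le_SUP) auto
      also note Gint
      finally obtain Y where Y: "0 \<le> Y" "Y \<le> (c * D) powr q"
        "(\<integral>\<^sup>+x. ennreal (norm (frac_integral \<alpha> (\<lambda>y. \<sigma> y *\<^sub>R f y) x) powr q) \<partial>weight_measure w) = ennreal Y"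
        by (auto simp: le_ennreal_iff)
      have "Lp_norm q (weight_measure w) (frac_integral \<alpha> (\<lambda>y. \<sigma> y *\<^sub>R f y)) = ennreal (Y powr (1 / q))"
        unfolding Lp_norm_def Y(3) ennreal_powr_def using Y(1) by simp
      also have "Y powr (1 / q) \<le> ((c * D) powr q) powr (1 / q)"
        using Y q1 by (intro powr_mono2) auto
      also have "\<dots> = C * K * b * If powr (1 / p)"
      proof -
        have "((c * D) powr q) powr (1 / q) = c * D" using q1 c0 D0 by (simp add: powr_powr)
        also have "\<dots> = C * K * b * If powr (1 / p)" unfolding D_def C_def K_def by (simp add: mult_ac)
        finally show ?thesis .
      qed
      also have "ennreal (C * K * b * If powr (1 / p)) = ennreal C * ennreal K * ennreal b * ennreal (If powr (1 / p))"
        using C0 K0 unfolding b_def by (simp add: ennreal_mult)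
      also have "ennreal b = entropy_bracket \<alpha> p q \<epsilon> \<epsilon>' \<sigma> w" unfolding b_def using B by simp
      also have "ennreal (If powr (1 / p)) = Lp_norm p (weight_measure \<sigma>) f" unfolding fL(3) If_def ..
      finally show "Lp_norm q (weight_measure w) (frac_integral \<alpha> (\<lambda>y. \<sigma> y *\<^sub>R f y))
          \<le> ennreal C * ennreal K * entropy_bracket \<alpha> p q \<epsilon> \<epsilon>' \<sigma> w * Lp_norm p (weight_measure \<sigma>) f"
        by (simp add: ennreal_leI)
    qed
  qed
qed

end
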